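(* Let $m \ge 1$ be an integer, let $V > 0$, and let $f : (0,1) \to \mathbb{R}$ be a continuous probability density. Assume that for every sequence $(f_u)_{u \ge 1}$ of functions in which each $f_u$ is either $t \mapsto f(t)$ or $t \mapsto f(1-t)$ one has $$\lim_{N\to\infty} \sum_{\substack{\ell = -\infty \\ \ell \neq 0}}^{\infty} \left| \prod_{u=1}^{Nm} \mathcal{M}_{f_u}\!\left(1 - \frac{2\pi i \ell}{\log 10}\right) \right| = 0 .$$ Start with an $m$-dimensional box of $m$-dimensional volume $V$ and perform $N$ iterations of the unrestricted $m$-dimensional fragmentation process (described in the context), in which the cutting proportions $p_1, p_2, \dots, p_{2^{Nm}-1}$ are independent random variables, each with density $f$. Let $V_1, \dots, V_{2^{mN}}$ be the $m$-dimensional volumes of the resulting $(2^m)^N = 2^{mN}$ pieces, listed from left to right, so that $$V_1 = V\, p_1 p_2 p_4 \cdots p_{2^{Nm-2}}\, p_{2^{Nm-1}}, \quad \dots, \quad V_{(2^m)^N} = V (1-p_1)(1-p_3)(1-p_7)\cdots (1-p_{2^{Nm-1}-1})(1-p_{2^{Nm}-1}).$$ For $s \in [1,10)$ let $$P_N(s) := \frac{\sum_{i=1}^{(2^m)^N} \varphi_s(V_i)}{(2^m)^N}$$ be the fraction of pieces whose volume has (base $10$) significand at most $s$. Then for every $s \in [1,10)$: 1. $\displaystyle \lim_{N\to\infty} \mathbb{E}[P_N(s)] = \log_{10} s$, and 2. $\displaystyle \lim_{N\to\infty} \mathrm{Var}(P_N(s)) = 0$.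
   Context: Mellin transform: for a function $g$ on $(0,\infty)$, $\mathcal{M}_g(s) := \int_0^\infty g(t)\, t^{s}\, \frac{dt}{t}$ for complex $s$. A density on $(0,1)$ is extended by $0$ outside $(0,1)$, so for such a density $\mathcal{M}_g(s) = \int_0^1 g(t)\, t^{s-1}\, dt$. Here $\log$ is the natural logarithm. The function $t \mapsto f(1-t)$ is the density of $1-P$ when $P$ has density $f$. Significand: every $x > 0$ can be written uniquely as $x = a \cdot 10^{n}$ with $a \in [1,10)$ and $n \in \mathbb{Z}$; the number $a$ is the (base $10$) significand of $x$. For $s \in [1,10)$, $\varphi_s(x) := 1$ if the significand of $x$ is at most $s$, and $\varphi_s(x) := 0$ otherwise. Unrestricted $m$-dimensional fragmentation process: cutting a piece of volume $W$ with proportion $p \in (0,1)$ along a coordinate direction (by a hyperplane perpendicular to that coordinate axis) replaces it by two boxes, a left one of volume $Wp$ and a right one of volume $W(1-p)$. One iteration consists of $m$ successive steps, one for each of the coordinate directions $x_1, \dots, x_m$; in each step every currently existing piece is cut along that direction, each piece with its own new proportion. Proportions are numbered consecutively, step by step, and from left to right among the pieces within a step: the initial box is cut with $p_1$; then the pieces $Vp_1$ and $V(1-p_1)$ are cut with $p_2$ and $p_3$ respectively; then the four resulting pieces, from left to right, with $p_4, p_5, p_6, p_7$; and so on, the next iteration starting again with direction $x_1$. Equivalently, in terms of volumes: consider the complete binary tree of depth $Nm$ with internal nodes labelled $1, \dots, 2^{Nm}-1$, root $1$, and node $k$ having left child $2k$ and right child $2k+1$; the leaves are $2^{Nm}, \dots,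 2^{Nm+1}-1$. Give the edge from $k$ to $2k$ the weight $p_k$ and the edge from $k$ to $2k+1$ the weight $1-p_k$. Then $V_i$ (for $1 \le i \le 2^{Nm}$) is $V$ times the product of the $Nm$ edge weights on the path from the root to the leaf $2^{Nm}+i-1$. *)

theory Defs
  imports "HOL-Probability.Probability"
begin

text \<open>Integral of g(t) t^s dt/t over the positive reals.\<close>

definition mellin :: "(real \<Rightarrow> real) \<Rightarrow> complex \<Rightarrow> complex" where
  "mellin g s =
     (LINT t:{0<..}|lborel. complex_of_real (g t) * complex_of_real t powr s / complex_of_real t)"

text \<open>
  A probability density on (0,1), already extended by 0 to a function on the whole real line;
  continuity is only required inside the interval.
\<close>

definition cont_prob_density01 :: "(real \<Rightarrow> real) \<Rightarrow> bool" where
  "cont_prob_density01 f \<longleftrightarrow>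
     continuous_on {0<..<1} f \<and>
     (\<forall>t\<in>{0<..<1}. 0 \<le> f t) \<and>
     (\<forall>t. t \<notin> {0<..<1} \<longrightarrow> f t = 0) \<and>
     (\<integral>\<^sup>+t. ennreal (f t) \<partial>lborel) = 1"

text \<open>
  Only meaningful for x > 0. For other x the value is unspecified but does not depend on x,
  which is harmless since the volumes below are almost surely positive.
\<close>

definition significand :: "real \<Rightarrow> real" where
  "significand x = (THE a. 1 \<le> a \<and> a < 10 \<and> (\<exists>n::int. x = a * 10 powi n))"

definition phi :: "real \<Rightarrow> real \<Rightarrow> real" where
  "phi s x = (if significand x \<le> s then 1 else 0)"

lemma significand_ex1:
  fixes x :: real
  assumes "x > 0"
  shows "\<exists>!a. 1 \<le> a \<and> a < 10 \<and> (\<exists>n::int. x = a * 10 powi n)"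
proof (rule ex_ex1I)
  define n where "n = \<lfloor>log 10 x\<rfloor>"
  have p: "(10::real) powi n = 10 powr real_of_int n"
    by (simp add: powr_real_of_int')
  have "10 powr real_of_int n \<le> x"
    using assms by (metis n_def le_log_iff of_int_floor_le one_less_numeral_iff semiring_norm(76))
  moreover have "x < 10 powr (real_of_int n + 1)"
    using assms by (metis n_def log_less_iff real_of_int_floor_add_one_gt one_less_numeral_iff semiring_norm(76))
  ultimately have "1 \<le> x / 10 powi n \<and> x / 10 powi n < 10 \<and> (\<exists>k::int. x = (x / 10 powi n) * 10 powi k)"
    unfolding p[symmetric] by (auto simp: powr_add p divide_simps intro!: exI[of _ n])
  then show "\<exists>a. 1 \<le> a \<and> a < 10 \<and> (\<exists>n::int. x = a * 10 powi n)" by blast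
next
  fix a b assume a: "1 \<le> a \<and> a < 10 \<and> (\<exists>n::int. x = a * 10 powi n)"
    and b: "1 \<le> b \<and> b < 10 \<and> (\<exists>n::int. x = b * 10 powi n)"
  have *: "n \<le> k" if "c * 10 powi n = d * 10 powi k" "1 \<le> c" "d < 10" for c d :: real and n k :: int
  proof (rule ccontr)
    assume "\<not> n \<le> k"
    then have "(10::real) powi (k + 1) \<le> 10 powi n" by (intro power_int_increasing) auto
    also have "\<dots> \<le> c * 10 powi n"
      using mult_right_mono[of 1 c "10 powi n"] that by simp
    also have "\<dots> < 10 * 10 powi k" using that by simp
    finally show False by (simp add: power_int_add)
  qed
  from a b obtain n k where nk: "x = a * 10 powi n" "x = b * 10 powi k" by blast
  then have "n = k" using a b *[of a n b k] *[of b k a n] by simp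
  then show "a = b" using nk by simp
qed

lemma significand_eqI:
  assumes "1 \<le> a" "a < 10" "x = a * 10 powi n"
  shows "significand x = a"
proof -
  have "x > 0" using assms by simp
  then show ?thesis unfolding significand_def
    using assms by (intro the1_equality significand_ex1) auto
qed

text \<open>
  An m-dimensional box is given by its intervals (lower end, upper end) in the coordinates
  j < m; coordinates are counted from 0 and the values at j >= m are ignored.
\<close>

type_synonym cbounds = "nat \<Rightarrow> real \<times> real"

definition is_box :: "nat \<Rightarrow> cbounds \<Rightarrow> bool" where
  "is_box m B \<longleftrightarrow> (\<forall>j<m. fst (B j) < snd (B j))"

definition box_volume :: "nat \<Rightarrow> cbounds \<Rightarrow> real" where
  "box_volume m B = (\<Prod>j<m. snd (B j) - fst (B j))"

definition cut_box :: "nat \<Rightarrow> real \<Rightarrow> cbounds \<Rightarrow> cbounds list" where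
  "cut_box j q B =
     (let a = fst (B j); b = snd (B j); c = a + q * (b - a)
      in [B(j := (a, c)), B(j := (c, b))])"

text \<open>
  One step, applied to the list of current pieces from left to right. When there are n = 2^d
  pieces, the proportions 1, ..., n - 1 have been used in the previous steps, so the next ones
  are n, n + 1, ..., 2n - 1.
\<close>

definition cut_all :: "(nat \<Rightarrow> real) \<Rightarrow> nat \<Rightarrow> cbounds list \<Rightarrow> cbounds list" where
  "cut_all p j L = concat (map (\<lambda>i. cut_box j (p (length L + i)) (L ! i)) [0..<length L])"

definition iteration :: "nat \<Rightarrow> (nat \<Rightarrow> real) \<Rightarrow> cbounds list \<Rightarrow> cbounds list" where
  "iteration m p L = fold (cut_all p) [0..<m] L"

definition fragmentation :: "nat \<Rightarrow> (nat \<Rightarrow> real) \<Rightarrow> cbounds \<Rightarrow> nat \<Rightarrow> cbounds list" where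
  "fragmentation m p B N = (iteration m p ^^ N) [B]"

definition piece_volume :: "nat \<Rightarrow> (nat \<Rightarrow> real) \<Rightarrow> cbounds \<Rightarrow> nat \<Rightarrow> nat \<Rightarrow> real" where
  "piece_volume m p B N i = box_volume m (fragmentation m p B N ! (i - 1))"

definition frac_pieces :: "nat \<Rightarrow> (nat \<Rightarrow> real) \<Rightarrow> cbounds \<Rightarrow> nat \<Rightarrow> real \<Rightarrow> real" where
  "frac_pieces m p B N s =
     (\<Sum>i=1..(2 ^ m) ^ N. phi s (piece_volume m p B N i)) / (2 ^ m) ^ N"

text \<open>
  The volumes as products along the paths of the binary tree with root 1 in which node k has
  the children 2k and 2k + 1: see piece_volume_eq.
\<close>

fun tree_weight :: "(nat \<Rightarrow> real) \<Rightarrow> nat \<Rightarrow> real" where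
  "tree_weight p k =
     (if k \<le> 1 then 1
      else tree_weight p (k div 2) * (if even k then p (k div 2) else 1 - p (k div 2)))"

declare tree_weight.simps [simp del]

lemma tree_double: "k \<ge> 1 \<Longrightarrow> tree_weight p (2 * k) = tree_weight p k * p k"
  by (subst tree_weight.simps) simp

lemma tree_double_1: "k \<ge> 1 \<Longrightarrow> tree_weight p (2 * k + 1) = tree_weight p k * (1 - p k)"
  by (subst tree_weight.simps) simp

lemma box_volume_cut:
  assumes "j < m"
  shows "map (box_volume m) (cut_box j q B) = [box_volume m B * q, box_volume m B * (1 - q)]"
proof -
  have "box_volume m (B(j := x)) = (snd x - fst x) * (\<Prod>i\<in>{..<m} - {j}. snd (B i) - fst (B i))" for x
    unfolding box_volume_def using assms by (subst prod.remove[of _ j]) auto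
  moreover have "box_volume m B = (snd (B j) - fst (B j)) * (\<Prod>i\<in>{..<m} - {j}. snd (B i) - fst (B i))"
    unfolding box_volume_def using assms by (subst prod.remove[of _ j]) auto
  ultimately show ?thesis
    by (simp add: cut_box_def Let_def del: fun_upd_apply) (simp add: algebra_simps)
qed

lemma upt_double: "concat (map (\<lambda>i. [2 * i, 2 * i + 1]) [a..<b]) = [2 * a..<2 * (b::nat)]" if "a \<le> b"
  using that by (induction b rule: dec_induct) simp_all

lemma cut_all_tree:
  assumes "j < m" "n \<ge> 1" "map (box_volume m) L = map (\<lambda>k. V * tree_weight p k) [n..<2 * n]"
  shows "map (box_volume m) (cut_all p j L) = map (\<lambda>k. V * tree_weight p k) [2 * n..<2 * (2 * n)]"
proof -
  have len: "length L = n" using arg_cong[OF assms(3), of length] by simp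
  have vol: "box_volume m (L ! i) = V * tree_weight p (n + i)" if "i < n" for i
    using arg_cong[OF assms(3), of "\<lambda>l. l ! i"] that len by simp
  have "map (box_volume m) (cut_all p j L) =
      concat (map (\<lambda>i. map (box_volume m) (cut_box j (p (n + i)) (L ! i))) [0..<n])"
    by (simp add: cut_all_def len map_concat comp_def)
  also have "\<dots> = concat (map (\<lambda>i. map (\<lambda>k. V * tree_weight p k) [2 * (i + n), 2 * (i + n) + 1]) [0..<n])"
    using assms(2)
    by (intro arg_cong[of _ _ concat] map_cong refl)
       (simp add: box_volume_cut[OF assms(1)] vol tree_double tree_double_1[simplified] add.commute mult.assoc
          del: mult_Suc_right add_mult_distrib2 distrib_left_numeral)
  also have "\<dots> = map (\<lambda>k. V * tree_weight p k)
      (concat (map (\<lambda>i. [2 * i, 2 * i + 1]) (map (\<lambda>i. i + n) [0..<n])))"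
    by (simp add: map_concat comp_def)
  also have "map (\<lambda>i. i + n) [0..<n] = [n..<2 * n]"
    by (simp add: map_add_upt mult_2)
  finally show ?thesis using upt_double[of n "2 * n"] by simp
qed

lemma fragmentation_tree:
  "map (box_volume m) (fragmentation m p B N) =
     map (\<lambda>k. box_volume m B * tree_weight p k) [2 ^ (N * m)..<2 * 2 ^ (N * m)]"
proof (induction N)
  case 0
  show ?case by (simp add: fragmentation_def tree_weight.simps numeral_2_eq_2)
next
  case (Suc N)
  let ?n = "2 ^ (N * m) :: nat"
  have "map (box_volume m) (fold (cut_all p) [0..<d] (fragmentation m p B N)) =
      map (\<lambda>k. box_volume m B * tree_weight p k) [?n * 2 ^ d..<2 * (?n * 2 ^ d)]" if "d \<le> m" for d
    using that
  proof (induction d)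
    case 0
    then show ?case using Suc by simp
  next
    case (Suc d)
    then show ?case using cut_all_tree[of d m "?n * 2 ^ d"] by (simp add: mult_ac)
  qed
  from this[of m] show ?case
    by (simp add: fragmentation_def iteration_def power_add mult_ac)
qed

lemma length_fragmentation: "length (fragmentation m p B N) = 2 ^ (N * m)"
  using arg_cong[OF fragmentation_tree[of m p B N], of length] by simp

lemma piece_volume_eq:
  assumes "1 \<le> i" "i \<le> 2 ^ (N * m)"
  shows "piece_volume m p B N i = box_volume m B * tree_weight p (2 ^ (N * m) + i - 1)"
  using arg_cong[OF fragmentation_tree[of m p B N], of "\<lambda>l. l ! (i - 1)"] assms
  by (simp add: piece_volume_def length_fragmentation)

end

theory Submission
  imports Defs
begin

text \<open>
  By Weyl's criterion it suffices that for every \<open>l \<noteq> 0\<close> the average over the leaves of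
  \<open>\<chi>(V\<^sub>i) = exp (2 \<pi> \<i> l log\<^sub>1\<^sub>0 V\<^sub>i)\<close> tends to 0 in mean square.
  The character is multiplicative, so with \<open>T\<^sub>d\<close> the sum of \<open>\<chi>\<close> over the nodes of level \<open>d\<close>
  one has \<open>T\<^sub>d\<^sub>+\<^sub>1 = \<Sum>\<^sub>k \<chi>(W\<^sub>k) (\<chi>(p\<^sub>k) + \<chi>(1 - p\<^sub>k))\<close>, where \<open>W\<^sub>k\<close> is the weight of node \<open>k\<close>. The
  second factors are independent of each other and of all \<open>W\<^sub>k\<close>, with common mean \<open>\<mu>\<close>; expanding the
  square gives \<open>E|T\<^sub>d\<^sub>+\<^sub>1|\<^sup>2 \<le> 4 \<sqdot> 2\<^sup>d + |\<mu>|\<^sup>2 E|T\<^sub>d|\<^sup>2\<close>. The Mellin hypothesis for the constant sequence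
  \<open>f\<close> yields \<open>|E \<chi>(p\<^sub>k)| < 1\<close>, hence \<open>|\<mu>| < 2\<close>, and \<open>E|T\<^sub>n / 2\<^sup>n|\<^sup>2 \<rightarrow> 0\<close>. Thus
  \<open>P\<^sub>N(s) \<rightarrow> log\<^sub>1\<^sub>0 s\<close> in \<open>L\<^sup>1\<close>, which gives both the mean and the variance because \<open>0 \<le> P\<^sub>N(s) \<le> 1\<close>.
\<close>

section \<open>Trigonometric polynomials\<close>

lemma cis_2pi_eq_iff: "cis (2 * pi * x) = cis (2 * pi * y) \<longleftrightarrow> (\<exists>n::int. x = y + of_int n)"
proof -
  have "cis (2 * pi * x) = cis (2 * pi * y) \<longleftrightarrow> (\<exists>n::int. 2 * pi * x = 2 * pi * y + 2 * pi * of_int n)"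
    using sin_cos_eq_iff[of "2 * pi * x" "2 * pi * y"] by (auto simp: complex_eq_iff)
  also have "\<dots> \<longleftrightarrow> (\<exists>n::int. 2 * pi * x = 2 * pi * (y + of_int n))"
    by (simp add: algebra_simps)
  finally show ?thesis by simp
qed

text \<open>Generating the class from monomials by sums lets every statement that is additive in the
  polynomial be proved by induction. Coefficients are complex; a real polynomial \<open>h\<close> is
  handled as \<open>\<lambda>x. complex_of_real (h x)\<close>.\<close>

inductive trig_poly :: "(real \<Rightarrow> complex) \<Rightarrow> bool" where
  monom: "trig_poly (\<lambda>x. c * cis (2 * pi * of_int l * x))"
| add: "trig_poly g \<Longrightarrow> trig_poly h \<Longrightarrow> trig_poly (\<lambda>x. g x + h x)"

lemma trig_poly_const: "trig_poly (\<lambda>x. c)"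
  using trig_poly.monom[of c 0] by simp

lemma trig_poly_mult:
  assumes "trig_poly g" "trig_poly h"
  shows "trig_poly (\<lambda>x. g x * h x)"
  using assms(1)
proof induction
  case (monom c l)
  show ?case
    using assms(2)
  proof induction
    case (monom d k)
    have eq: "(\<lambda>x. c * cis (2 * pi * of_int l * x) * (d * cis (2 * pi * of_int k * x)))
        = (\<lambda>x. (c * d) * cis (2 * pi * of_int (l + k) * x))"
      by (simp add: cis_mult [symmetric] distrib_left distrib_right mult_ac)
    show ?case
      unfolding eq by (rule trig_poly.monom)
  next
    case (add g h)
    then show ?case
      using trig_poly.add by (simp add: distrib_left)
  qed
next
  case (add g h)
  then show ?case
    using trig_poly.add by (simp add: distrib_right)
qed

lemma trig_poly_continuous_on: "trig_poly h \<Longrightarrow> continuous_on A h"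
  by (induction rule: trig_poly.induct) (auto intro!: continuous_intros)

lemma trig_poly_measurable [measurable_dest]: "trig_poly h \<Longrightarrow> h \<in> borel_measurable borel"
  by (intro borel_measurable_continuous_onI trig_poly_continuous_on)

lemma trig_poly_bounded: "trig_poly h \<Longrightarrow> \<exists>C. \<forall>x. cmod (h x) \<le> C"
proof (induction rule: trig_poly.induct)
  case (monom c l)
  show ?case by (auto simp: norm_mult)
next
  case (add g h)
  then obtain C D where "\<And>x. cmod (g x) \<le> C" "\<And>x. cmod (h x) \<le> D" by blast
  then have "cmod (g x + h x) \<le> C + D" for x
    by (meson add_mono norm_triangle_ineq order_trans)
  then show ?case by blast
qed

text \<open>Transfers polynomial approximation on the unit circle to trigonometric polynomials. A
  real-linear functional of \<open>cis t\<close> is a combination of \<open>cos t\<close> and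
  \<open>sin t\<close>, hence of \<open>cis t\<close> and \<open>cis (- t)\<close>; constants, sums
  and products stay in the class.\<close>

lemma trig_poly_real_polynomial_cis:
  assumes "real_polynomial_function q"
  shows "trig_poly (\<lambda>x. complex_of_real (q (cis (2 * pi * x))))"
  using assms
proof induction
  case (linear q)
  interpret bounded_linear q by fact
  \<comment> \<open>These coefficients come from rewriting \<open>cos t\<close> and
    \<open>sin t\<close> in \<open>cos t * q 1 + sin t * q \<i>\<close> through \<open>cis t\<close>
    and \<open>cis (- t)\<close>.\<close>
  define A where "A = (complex_of_real (q 1) - \<i> * complex_of_real (q \<i>)) / 2"
  define B where "B = (complex_of_real (q 1) + \<i> * complex_of_real (q \<i>)) / 2"
  have "complex_of_real (q (cis t)) = A * cis t + B * cis (- t)" for t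
  proof -
    have "cis t = cos t *\<^sub>R 1 + sin t *\<^sub>R \<i>"
      by (simp add: complex_eq_iff)
    then have "q (cis t) = cos t * q 1 + sin t * q \<i>"
      by (metis add scale real_scaleR_def)
    then show ?thesis
      by (simp add: A_def B_def complex_eq_iff field_simps)
  qed
  then show ?case
    using trig_poly.add[OF trig_poly.monom[of A 1] trig_poly.monom[of B "-1"]] by simp
next
  case (const c)
  show ?case by (rule trig_poly_const)
next
  case (add f g)
  then show ?case using trig_poly.add by simp
next
  case (mult f g)
  then show ?case using trig_poly_mult by simp
qed

text \<open>Since \<open>k\<close> is a nonzero multiple of \<open>2 * pi\<close>, the
  antiderivative \<open>c / (\<i> * k) * cis (k * x)\<close> exists and takes the same value at 0
  and 1.\<close>

lemma integral_trig_monom: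
  assumes "l \<noteq> 0"
  shows "integral {0..1::real} (\<lambda>x. c * cis (2 * pi * of_int l * x)) = 0"
proof -
  define k where "k = 2 * pi * real_of_int l"
  have k: "k \<noteq> 0" using assms by (simp add: k_def)
  have cancel: "u / d * (E * d) = u * E" if "d \<noteq> 0" for u d E :: complex
    using that by simp
  have "((\<lambda>x. c * cis (k * x)) has_integral
      c / (\<i> * k) * cis (k * 1) - c / (\<i> * k) * cis (k * 0)) {0..1}"
  proof (rule fundamental_theorem_of_calculus)
    fix x :: real
    have "((\<lambda>x. c / (\<i> * k) * exp (x *\<^sub>R (\<i> * k))) has_vector_derivative
        c / (\<i> * k) * (exp (x *\<^sub>R (\<i> * k)) * (\<i> * k))) (at x within {0..1})"
      by (intro has_vector_derivative_mult_right exp_scaleR_has_vector_derivative_right)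
    moreover have "c / (\<i> * k) * (exp (x *\<^sub>R (\<i> * k)) * (\<i> * k)) = c * exp (x *\<^sub>R (\<i> * k))"
      by (rule cancel) (use k in simp)
    moreover have "exp (x *\<^sub>R (\<i> * k)) = cis (k * x)" for x
      by (simp add: cis_conv_exp scaleR_conv_of_real mult_ac)
    ultimately show "((\<lambda>x. c / (\<i> * k) * cis (k * x)) has_vector_derivative c * cis (k * x)) (at x within {0..1})"
      by simp
  qed simp
  moreover have "cis (k * 1) = 1"
    unfolding k_def using cis_multiple_2pi[of "real_of_int l"] by simp
  ultimately have "((\<lambda>x. c * cis (2 * pi * of_int l * x)) has_integral 0) {0..1}"
    unfolding k_def by simp
  then show ?thesis by (rule integral_unique)
qed

text \<open>
  The complement of an arc is again an arc, so these majorants also provide the minorants needed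
  in Weyl's criterion.
\<close>

lemma arc_trig_poly_upper:
  fixes a b \<epsilon> :: real
  assumes ab: "0 \<le> a" "a \<le> b" "b \<le> 1" and \<epsilon>: "\<epsilon> > 0"
  obtains h :: "real \<Rightarrow> real" where
    "trig_poly (\<lambda>x. complex_of_real (h x))"
    "\<And>x. 0 \<le> h x"
    "\<And>x n. x - of_int n \<in> {a..b} \<Longrightarrow> 1 \<le> h x"
    "integral {0..1} h \<le> b - a + \<epsilon>"
proof -
  define e where "e x = cis (2 * pi * x)" for x
  \<comment> \<open>The arc is moved to the unit circle, where 0 and 1 become one point: functions
    of \<open>e x\<close> are periodic automatically, and Stone-Weierstrass applies on a compact
    set.\<close>
  define K where "K = e ` {a..b}"
  have cont_e: "continuous_on A e" for A
    unfolding e_def by (intro continuous_intros)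
  have K: "compact K" "closed K" "K \<noteq> {}"
    using ab cont_e unfolding K_def by (auto intro!: compact_continuous_image compact_imp_closed)
  \<comment> \<open>Tent functions: 1 on \<open>K\<close>, and for \<open>k > 0\<close> equal to 0
    once the distance to \<open>K\<close> reaches \<open>1 / k\<close>. As \<open>K\<close> is
    closed, they tend pointwise to its indicator.\<close>
  define g where "g k z = max 0 (1 - real k * infdist z K)" for k z
  have cont_g: "continuous_on A (g k)" for A k
    unfolding g_def by (intro continuous_intros)
  have cont_ge: "continuous_on A (\<lambda>x. g k (e x))" for A k
    by (rule continuous_on_compose2[OF cont_g[of UNIV] cont_e]) auto
  define lim where "lim x = (indicator K (e x) :: real)" for x
  have conv: "(\<lambda>k. g k (e x)) \<longlonglongrightarrow> lim x" for x
  proof (cases "e x \<in> K")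
    case True
    then show ?thesis by (simp add: g_def lim_def)
  next
    case False
    then have pos: "infdist (e x) K > 0"
      using K by (simp add: infdist_pos_not_in_closed)
    then obtain k0 :: nat where k0: "1 < real k0 * infdist (e x) K"
      using reals_Archimedean3 by blast
    have "\<forall>\<^sub>F k in sequentially. g k (e x) = 0"
    proof (rule eventually_sequentiallyI)
      fix k assume "k0 \<le> k"
      then have "real k0 * infdist (e x) K \<le> real k * infdist (e x) K"
        using pos by (intro mult_right_mono) auto
      then show "g k (e x) = 0" using k0 by (simp add: g_def)
    qed
    then show ?thesis using False by (simp add: lim_def tendsto_eventually)
  qed
  have g01: "0 \<le> g k z" "g k z \<le> 1" for k z
    by (auto simp: g_def infdist_nonneg)
  have "(\<lambda>k. integral {0..1} (\<lambda>x. g k (e x))) \<longlonglongrightarrow> integral {0..1} lim"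
  proof (rule dominated_convergence(2)[where h = "\<lambda>_. 1"])
    show "(\<lambda>x. g k (e x)) integrable_on {0..1}" for k
      by (intro integrable_continuous_real cont_ge)
  qed (use g01 conv in auto)
  moreover have "integral {0..1} lim = b - a"
  proof -
    have "((\<lambda>x. 1 :: real) has_integral b - a) {a..b}"
      using has_integral_const_real[of "1::real" a b] ab by simp
    then have "((\<lambda>x. if x \<in> {a..b} then 1 else 0 :: real) has_integral b - a) {0..1}"
      using ab by (subst has_integral_restrict) auto
    then have "(lim has_integral b - a) {0..1}"
    \<comment> \<open>The map \<open>e\<close> identifies 0 with 1, so \<open>lim\<close> may differ
      from the indicator of \<open>{a..b}\<close> at these two points. For \<open>x\<close> strictly
      between them the integer shift \<open>n\<close> must be 0.\<close>
    proof (rule has_integral_spike_finite[of "{0,1}", rotated 2])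
      fix x :: real assume x: "x \<in> {0..1} - {0, 1}"
      have "e x \<in> K \<longleftrightarrow> x \<in> {a..b}"
      proof
        assume "e x \<in> K"
        then obtain y where y: "y \<in> {a..b}" "e x = e y" unfolding K_def by blast
        then obtain n :: int where "x = y + of_int n"
          unfolding e_def cis_2pi_eq_iff by blast
        moreover from this have "n = 0" using x y ab by simp
        ultimately show "x \<in> {a..b}" using y by simp
      qed (auto simp: K_def)
      then show "lim x = (if x \<in> {a..b} then 1 else 0)" by (simp add: lim_def indicator_def)
    qed auto
    then show ?thesis by (rule integral_unique)
  qed
  ultimately have "\<forall>\<^sub>F k in sequentially. integral {0..1} (\<lambda>x. g k (e x)) < b - a + \<epsilon> / 2"
    using \<epsilon> by (intro order_tendstoD(2)) auto
  then obtain k where k: "integral {0..1} (\<lambda>x. g k (e x)) < b - a + \<epsilon> / 2"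
    by (meson eventually_sequentially order_refl)
  obtain q where q: "real_polynomial_function q"
      "\<And>z. z \<in> sphere 0 1 \<Longrightarrow> \<bar>g k z - q z\<bar> < \<epsilon> / 4"
    using Stone_Weierstrass_real_polynomial_function[OF compact_sphere[of 0 1] cont_g[of _ k], of "\<epsilon> / 4"] \<epsilon>
    by auto
  have qe: "\<bar>g k (e x) - q (e x)\<bar> < \<epsilon> / 4" for x
    by (intro q) (simp add: e_def)
  \<comment> \<open>Lifting the approximation by \<open>\<epsilon> / 4\<close> makes it a majorant
    of \<open>g k (e x)\<close> that exceeds it by at most \<open>\<epsilon> / 2\<close>; the other
    half of the error was spent on the choice of \<open>k\<close>.\<close>
  define h where "h x = q (e x) + \<epsilon> / 4" for x
  have trig: "trig_poly (\<lambda>x. complex_of_real (h x))"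
    unfolding h_def of_real_add
    by (intro trig_poly.add trig_poly_const) (use trig_poly_real_polynomial_cis[OF q(1)] in \<open>simp add: e_def\<close>)
  have bnd: "g k (e x) \<le> h x" "h x \<le> g k (e x) + \<epsilon> / 2" for x
    using qe[of x] unfolding h_def abs_less_iff by linarith+
  show thesis
  proof
    show "trig_poly (\<lambda>x. complex_of_real (h x))" by (fact trig)
    show "0 \<le> h x" for x using bnd(1)[of x] g01(1)[of k "e x"] by simp
    show "1 \<le> h x" if "x - of_int n \<in> {a..b}" for x n
    proof -
      have "e x = e (x - of_int n)"
        unfolding e_def cis_2pi_eq_iff by (rule exI[of _ n]) simp
      then have "e x \<in> K" using that by (auto simp: K_def)
      then have "g k (e x) = 1" by (simp add: g_def)
      then show ?thesis using bnd(1)[of x] by simp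
    qed
    have "continuous_on {0..1} (\<lambda>x. Re (complex_of_real (h x)))"
      by (intro continuous_on_Re trig_poly_continuous_on trig)
    then have "integral {0..1} h \<le> integral {0..1} (\<lambda>x. g k (e x) + \<epsilon> / 2)"
      by (intro integral_le integrable_continuous_real continuous_on_add cont_ge continuous_on_const bnd) simp
    also have "\<dots> = integral {0..1} (\<lambda>x. g k (e x)) + \<epsilon> / 2"
      by (subst integral_add) (auto intro!: integrable_continuous_real cont_ge)
    finally show "integral {0..1} h \<le> b - a + \<epsilon>"
      using k by simp
  qed
qed

section \<open>Second moments along the binary tree\<close>

lemma sum_double_interval:
  fixes g :: "nat \<Rightarrow> 'b::comm_monoid_add"
  assumes "a \<le> b"
  shows "(\<Sum>j\<in>{2 * a..<2 * b}. g j) = (\<Sum>k\<in>{a..<b}. g (2 * k) + g (2 * k + 1))"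
  using assms by (induction b rule: dec_induct) (simp_all add: add.assoc)

text \<open>Products along the path from the root with arbitrary edge functions, \<open>a\<close> to
  the left and \<open>b\<close> to the right. The choice \<open>t\<close> and \<open>1 - t\<close>
  recovers \<open>tree_weight\<close>; characters of these two give the character of
  \<open>tree_weight\<close>.\<close>

fun path_prod :: "(real \<Rightarrow> 'b) \<Rightarrow> (real \<Rightarrow> 'b) \<Rightarrow> (nat \<Rightarrow> real) \<Rightarrow> nat \<Rightarrow> 'b::comm_monoid_mult" where
  "path_prod a b x k =
     (if k \<le> 1 then 1
      else path_prod a b x (k div 2) * (if even k then a (x (k div 2)) else b (x (k div 2))))"

declare path_prod.simps [simp del]

lemma path_prod_one [simp]: "path_prod a b x (Suc 0) = 1"
  by (simp add: path_prod.simps)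

lemma path_prod_double: "k \<ge> 1 \<Longrightarrow> path_prod a b x (2 * k) = path_prod a b x k * a (x k)"
  by (subst path_prod.simps) simp

lemma path_prod_double_1: "k \<ge> 1 \<Longrightarrow> path_prod a b x (2 * k + 1) = path_prod a b x k * b (x k)"
  by (subst path_prod.simps) simp

text \<open>Every proper ancestor of a node below \<open>2 * n\<close> is below \<open>n\<close>.
  With \<open>n = 2 ^ d\<close>, the product at a node of level \<open>d\<close> involves only
  proportions of earlier levels, which is the source of independence in the second-moment
  step.\<close>

lemma path_prod_cong:
  "k < 2 * n \<Longrightarrow> (\<And>i. i \<in> {1..<n} \<Longrightarrow> x i = y i) \<Longrightarrow> path_prod a b x k = path_prod a b y k"
proof (induction k rule: less_induct)
  case (less k)
  show ?case
  proof (cases "k \<le> 1")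
    case True
    then show ?thesis by (simp add: path_prod.simps)
  next
    case False
    then have "k div 2 < k" "k div 2 < 2 * n" "k div 2 \<in> {1..<n}"
      using less.prems(1) by auto
    then have "path_prod a b x (k div 2) = path_prod a b y (k div 2)" "x (k div 2) = y (k div 2)"
      using less.IH less.prems(2) by blast+
    then show ?thesis
      by (simp add: path_prod.simps[of _ _ _ k])
  qed
qed

lemma norm_path_prod:
  fixes a b :: "real \<Rightarrow> 'b::real_normed_field"
  assumes "\<And>x. norm (a x) = 1" "\<And>x. norm (b x) = 1"
  shows "norm (path_prod a b x k) = 1"
proof (induction k rule: less_induct)
  case (less k)
  then show ?case
    using assms by (subst path_prod.simps) (auto simp: norm_mult)
qed

lemma path_prod_measurable:
  fixes a b :: "real \<Rightarrow> 'b::{second_countable_topology, real_normed_field}"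
  assumes [measurable]: "a \<in> borel_measurable borel" "b \<in> borel_measurable borel"
    and X: "\<And>i. i \<in> {1..<n} \<Longrightarrow> (\<lambda>w. X w i) \<in> borel_measurable M"
    and "k < 2 * n"
  shows "(\<lambda>w. path_prod a b (X w) k) \<in> borel_measurable M"
  using \<open>k < 2 * n\<close>
proof (induction k rule: less_induct)
  case (less k)
  show ?case
  proof (cases "k \<le> 1")
    case True
    then show ?thesis by (simp add: path_prod.simps)
  next
    case False
    then have [measurable]: "(\<lambda>w. path_prod a b (X w) (k div 2)) \<in> borel_measurable M"
        "(\<lambda>w. X w (k div 2)) \<in> borel_measurable M"
      using less.prems by (auto intro!: less.IH X)
    show ?thesis
      by (cases "even k") (simp_all add: path_prod.simps[of _ _ _ k] False)
  qed
qed

section \<open>Independence and the second-moment recursion\<close>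

context prob_space
begin

text \<open>Functions of disjoint blocks of independent variables are independent; the blocks are
  \<open>S\<close>, \<open>{k}\<close> and \<open>{k'}\<close>. Boundedness supplies the
  integrability for the product formula. In its use, \<open>S\<close> consists of all nodes on
  levels above that of \<open>k\<close> and \<open>k'\<close>.\<close>

lemma expectation_indep_split:
  fixes G :: "(nat \<Rightarrow> real) \<Rightarrow> complex" and y :: "real \<Rightarrow> complex"
  assumes indep: "indep_vars (\<lambda>_. borel) p I"
    and S: "S \<subseteq> I" "k \<in> I" "k' \<in> I" "k \<notin> S" "k' \<notin> S" "k \<noteq> k'"
    and G [measurable]: "G \<in> borel_measurable (PiM S (\<lambda>_. borel))"
    and G_bound: "\<And>x. norm (G x) \<le> C"
    and y [measurable]: "y \<in> borel_measurable borel" "z \<in> borel_measurable borel"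
    and yz_bound: "\<And>x. norm (y x) \<le> D" "\<And>x. norm (z x) \<le> D"
  shows "expectation (\<lambda>w. G (\<lambda>i\<in>S. p i w) * (y (p k w) * z (p k' w)))
       = expectation (\<lambda>w. G (\<lambda>i\<in>S. p i w)) * (expectation (\<lambda>w. y (p k w)) * expectation (\<lambda>w. z (p k' w)))"
proof -
  \<comment> \<open>The three blocks and the three functions become families over
    \<open>{0,1,2}\<close>; index 2 is the last \<open>else\<close> branch.\<close>
  define L where "L j = (if j = 0 then S else if j = 1 then {k} else {k'})" for j :: nat
  define Y where "Y j = (if j = 0 then G else if j = 1 then (\<lambda>x. y (x k)) else (\<lambda>x. z (x k')))" for j :: nat
  have "indep_vars (\<lambda>j. PiM (L j) (\<lambda>_. borel)) (\<lambda>j w. \<lambda>i\<in>L j. p i w) {0,1,2}"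
    by (rule indep_vars_restrict[OF indep]) (use S in \<open>auto simp: L_def disjoint_family_on_def\<close>)
  moreover have Ym: "Y j \<in> borel_measurable (PiM (L j) (\<lambda>_. borel))" for j
    by (auto simp: Y_def L_def)
  ultimately have ind: "indep_vars (\<lambda>_. borel) (\<lambda>j w. Y j (\<lambda>i\<in>L j. p i w)) {0,1,2}"
    by (intro indep_vars_compose2[where Y = Y and N = "\<lambda>_. borel"])
  have int: "integrable M (\<lambda>w. Y j (\<lambda>i\<in>L j. p i w))" if "j \<in> {0,1,2}" for j
  proof (rule integrable_const_bound[where B = "max C D"])
    show "(\<lambda>w. Y j (\<lambda>i\<in>L j. p i w)) \<in> borel_measurable M"
      using ind that by (auto simp: indep_vars_def)
    show "AE w in M. norm (Y j (\<lambda>i\<in>L j. p i w)) \<le> max C D"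
      using G_bound yz_bound by (auto simp: Y_def le_max_iff_disj)
  qed
  have "expectation (\<lambda>w. \<Prod>j\<in>{0,1,2}. Y j (\<lambda>i\<in>L j. p i w))
      = (\<Prod>j\<in>{0,1,2}. expectation (\<lambda>w. Y j (\<lambda>i\<in>L j. p i w)))"
    by (rule indep_vars_lebesgue_integral[OF _ ind int]) auto
  then show ?thesis by (simp add: Y_def L_def)
qed

text \<open>The square is expanded over pairs \<open>k\<close>, \<open>k'\<close> of nodes of level
  \<open>d\<close>. For \<open>k \<noteq> k'\<close> independence extracts the factor
  \<open>\<mu> * cnj \<mu>\<close>; each of the \<open>2 ^ d\<close> diagonal terms is at most 4
  because \<open>norm (a x + b x) \<le> 2\<close>.\<close>

lemma path_sum_second_moment_step:
  fixes a b :: "real \<Rightarrow> complex" and p :: "nat \<Rightarrow> 'a \<Rightarrow> real"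
  assumes indep: "indep_vars (\<lambda>_. borel) p {1..<2 ^ n}" and "d < n"
    and [measurable]: "a \<in> borel_measurable borel" "b \<in> borel_measurable borel"
    and unit: "\<And>x. norm (a x) = 1" "\<And>x. norm (b x) = 1"
    and mean: "\<And>k. k \<in> {1..<2 ^ n} \<Longrightarrow> expectation (\<lambda>w. a (p k w) + b (p k w)) = \<mu>"
  defines "T \<equiv> \<lambda>d w. \<Sum>k\<in>{2 ^ d..<2 ^ Suc d}. path_prod a b (\<lambda>i. p i w) k"
  shows "expectation (\<lambda>w. (norm (T (Suc d) w))\<^sup>2) \<le> 4 * 2 ^ d + (norm \<mu>)\<^sup>2 * expectation (\<lambda>w. (norm (T d w))\<^sup>2)"
proof -
  define Lv where "Lv = {2 ^ d..<2 ^ Suc d :: nat}"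
  define Z where "Z k w = path_prod a b (\<lambda>i. p i w) k" for k w
  define y where "y x = a x + b x" for x
  have cnj_measurable [measurable]: "cnj \<in> borel_measurable borel"
    by (intro borel_measurable_continuous_onI continuous_intros)
  have [measurable]: "y \<in> borel_measurable borel" unfolding y_def by measurable
  have "(2::nat) ^ Suc d \<le> 2 ^ n" "(2::nat) ^ d \<le> 2 ^ n" "(1::nat) \<le> 2 ^ d"
    using \<open>d < n\<close> by (auto intro!: power_increasing simp del: power_Suc)
  then have Lv_sub: "Lv \<subseteq> {1..<2 ^ n}" and S_sub: "{1..<2 ^ d} \<subseteq> {1..<2 ^ n :: nat}"
    by (auto simp: Lv_def)
  have Lv: "finite Lv" "card Lv = 2 ^ d" by (simp_all add: Lv_def)
  have pm [measurable]: "p k \<in> borel_measurable M" if "k \<in> {1..<2 ^ n}" for k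
    using indep that by (auto simp: indep_vars_def)
  have Zm: "Z k \<in> borel_measurable M" if "k \<in> Lv" for k
    unfolding Z_def
  proof (rule path_prod_measurable[where n = "2 ^ d"])
    fix i :: nat assume "i \<in> {1..<2 ^ d}"
    then show "p i \<in> borel_measurable M" using pm S_sub by blast
  qed (use that in \<open>auto simp: Lv_def\<close>)
  have Ym: "(\<lambda>w. y (p k w)) \<in> borel_measurable M" if "k \<in> Lv" for k
    using that Lv_sub by (auto intro!: measurable_compose[OF pm])
  have Z1: "norm (Z k w) = 1" for k w
    unfolding Z_def using unit by (rule norm_path_prod)
  have y2: "norm (y x) \<le> 2" for x
    unfolding y_def using norm_triangle_ineq[of "a x" "b x"] unit by simp
  have T_Suc: "T (Suc d) w = (\<Sum>k\<in>Lv. Z k w * y (p k w))" for w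
  proof -
    have "T (Suc d) w = (\<Sum>k\<in>Lv. path_prod a b (\<lambda>i. p i w) (2 * k) + path_prod a b (\<lambda>i. p i w) (2 * k + 1))"
      using sum_double_interval[of "2 ^ d" "2 ^ Suc d"] by (simp add: T_def Lv_def)
    also have "\<dots> = (\<Sum>k\<in>Lv. Z k w * y (p k w))"
      using Lv_sub by (intro sum.cong refl)
        (auto simp: Z_def y_def path_prod_double path_prod_double_1[simplified] distrib_left subset_iff)
    finally show ?thesis .
  qed
  have ZZ_int: "integrable M (\<lambda>w. Z k w * cnj (Z k' w))" if "k \<in> Lv" "k' \<in> Lv" for k k'
  proof -
    note [measurable] = Zm[OF that(1)] Zm[OF that(2)]
    show ?thesis by (intro integrable_const_bound[where B = 1]) (auto simp: norm_mult Z1)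
  qed
  have ZYZY_int: "integrable M (\<lambda>w. Z k w * cnj (Z k' w) * (y (p k w) * cnj (y (p k' w))))"
    if "k \<in> Lv" "k' \<in> Lv" for k k'
  proof (rule integrable_const_bound[where B = "2 * 2"])
    note [measurable] = Zm[OF that(1)] Zm[OF that(2)] Ym[OF that(1)] Ym[OF that(2)]
    show "(\<lambda>w. Z k w * cnj (Z k' w) * (y (p k w) * cnj (y (p k' w)))) \<in> borel_measurable M"
      by measurable
    have "norm (y u) * norm (y v) \<le> 2 * 2" for u v
      by (intro mult_mono y2) auto
    then show "AE w in M. norm (Z k w * cnj (Z k' w) * (y (p k w) * cnj (y (p k' w)))) \<le> 2 * 2"
      by (simp add: norm_mult Z1)
  qed
  have off_diagonal: "expectation (\<lambda>w. Z k w * cnj (Z k' w) * (y (p k w) * cnj (y (p k' w))))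
      = expectation (\<lambda>w. Z k w * cnj (Z k' w)) * (\<mu> * cnj \<mu>)"
    if k: "k \<in> Lv" "k' \<in> Lv" and ne: "k \<noteq> k'" for k k'
  proof -
    \<comment> \<open>Level \<open>d\<close> starts at \<open>2 ^ d\<close>, so this factor reads
      only the coordinates in \<open>{1..<2 ^ d}\<close>, a block that contains neither
      \<open>k\<close> nor \<open>k'\<close>.\<close>
    define G where "G x = path_prod a b x k * cnj (path_prod a b x k')" for x
    have G: "G (\<lambda>i\<in>{1..<2 ^ d}. p i w) = Z k w * cnj (Z k' w)" for w
    proof -
      have "path_prod a b (\<lambda>i\<in>{1..<2 ^ d}. p i w) j = Z j w" if "j \<in> Lv" for j
        unfolding Z_def by (rule path_prod_cong[of _ "2 ^ d"]) (use that in \<open>auto simp: Lv_def\<close>)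
      then show ?thesis using k by (simp add: G_def)
    qed
    have Gp: "(\<lambda>x. path_prod a b x j) \<in> borel_measurable (PiM {1..<2 ^ d} (\<lambda>_. borel))" if "j \<in> Lv" for j
      by (rule path_prod_measurable[where n = "2 ^ d"])
        (use that in \<open>auto simp: Lv_def intro!: measurable_component_singleton\<close>)
    have "expectation (\<lambda>w. G (\<lambda>i\<in>{1..<2 ^ d}. p i w) * (y (p k w) * cnj (y (p k' w))))
      = expectation (\<lambda>w. G (\<lambda>i\<in>{1..<2 ^ d}. p i w)) * (expectation (\<lambda>w. y (p k w)) * expectation (\<lambda>w. cnj (y (p k' w))))"
    proof (rule expectation_indep_split[OF indep S_sub, where C = 1 and D = 2])
      show "G \<in> borel_measurable (PiM {1..<2 ^ d} (\<lambda>_. borel))"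
        unfolding G_def using Gp k by (intro borel_measurable_times measurable_compose[OF _ cnj_measurable]) auto
      show "norm (G x) \<le> 1" for x
        using unit by (simp add: G_def norm_mult norm_path_prod)
    qed (use k ne Lv_sub y2 in \<open>auto simp: Lv_def\<close>)
    moreover have "expectation (\<lambda>w. y (p j w)) = \<mu>" if "j \<in> Lv" for j
      unfolding y_def using mean that Lv_sub by blast
    ultimately show ?thesis
      unfolding G using k by simp
  qed
  define E where "E k k' = expectation (\<lambda>w. Z k w * cnj (Z k' w))" for k k'
  define F where "F k k' = expectation (\<lambda>w. Z k w * cnj (Z k' w) * (y (p k w) * cnj (y (p k' w))))" for k k'
  \<comment> \<open>Used for both \<open>E\<close> and \<open>F\<close>, so that their off-diagonal
    sums can be compared term by term.\<close>
  have split: "(\<Sum>k\<in>Lv. \<Sum>k'\<in>Lv. H k k') = (\<Sum>k\<in>Lv. H k k) + (\<Sum>k\<in>Lv. \<Sum>k'\<in>Lv - {k}. H k k')"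
    for H :: "nat \<Rightarrow> nat \<Rightarrow> complex"
    using Lv(1) by (simp add: sum.distrib[symmetric] sum.remove cong: sum.cong)
  have E_diag: "E k k = 1" for k
  proof -
    have "Z k w * cnj (Z k w) = 1" for w
      by (simp add: complex_norm_square[symmetric] Z1)
    then show ?thesis by (simp add: E_def prob_space)
  qed
  have T_d: "complex_of_real (expectation (\<lambda>w. (norm (T d w))\<^sup>2)) = (\<Sum>k\<in>Lv. \<Sum>k'\<in>Lv. E k k')"
  proof -
    have "complex_of_real ((norm (T d w))\<^sup>2) = (\<Sum>k\<in>Lv. \<Sum>k'\<in>Lv. Z k w * cnj (Z k' w))" for w
      unfolding complex_norm_square by (simp add: T_def Lv_def Z_def sum_product)
    then show ?thesis
      by (simp add: E_def integral_complex_of_real[symmetric] integral_sum ZZ_int del: of_real_power of_real_mult)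
  qed
  have T_S: "complex_of_real (expectation (\<lambda>w. (norm (T (Suc d) w))\<^sup>2)) = (\<Sum>k\<in>Lv. \<Sum>k'\<in>Lv. F k k')"
  proof -
    have "complex_of_real ((norm (T (Suc d) w))\<^sup>2)
        = (\<Sum>k\<in>Lv. \<Sum>k'\<in>Lv. Z k w * cnj (Z k' w) * (y (p k w) * cnj (y (p k' w))))" for w
      unfolding complex_norm_square by (simp add: T_Suc sum_product mult_ac)
    then show ?thesis
      by (simp add: F_def integral_complex_of_real[symmetric] integral_sum ZYZY_int del: of_real_power of_real_mult)
  qed
  have "(\<Sum>k\<in>Lv. \<Sum>k'\<in>Lv - {k}. F k k') = \<mu> * cnj \<mu> * (\<Sum>k\<in>Lv. \<Sum>k'\<in>Lv - {k}. E k k')"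
    unfolding sum_distrib_left F_def E_def
    by (intro sum.cong refl, subst off_diagonal) (auto simp: mult.commute)
  \<comment> \<open>The diagonal of \<open>E\<close> sums to \<open>2 ^ d\<close> since each
    \<open>Z k w\<close> is unimodular; what remains of the level-\<open>d\<close> moment is the
    off-diagonal part.\<close>
  also have "(\<Sum>k\<in>Lv. \<Sum>k'\<in>Lv - {k}. E k k') = complex_of_real (expectation (\<lambda>w. (norm (T d w))\<^sup>2)) - 2 ^ d"
    unfolding T_d split by (simp add: E_diag Lv)
  finally have "complex_of_real (expectation (\<lambda>w. (norm (T (Suc d) w))\<^sup>2))
      = (\<Sum>k\<in>Lv. F k k) + complex_of_real ((norm \<mu>)\<^sup>2 * (expectation (\<lambda>w. (norm (T d w))\<^sup>2) - 2 ^ d))"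
    unfolding T_S split of_real_mult complex_norm_square by simp
  from arg_cong[OF this, of Re] have "expectation (\<lambda>w. (norm (T (Suc d) w))\<^sup>2)
      = Re (\<Sum>k\<in>Lv. F k k) + (norm \<mu>)\<^sup>2 * (expectation (\<lambda>w. (norm (T d w))\<^sup>2) - 2 ^ d)"
    by (simp only: plus_complex.sel Re_complex_of_real)
  moreover have "Re (\<Sum>k\<in>Lv. F k k) \<le> 4 * 2 ^ d"
  proof -
    have "Re (F k k) \<le> 4" if "k \<in> Lv" for k
    proof -
      have "norm (F k k) \<le> expectation (\<lambda>w. norm (Z k w * cnj (Z k w) * (y (p k w) * cnj (y (p k w)))))"
        unfolding F_def by (rule integral_norm_bound)
      also have "\<dots> \<le> expectation (\<lambda>w. 2 * 2)"
      proof (intro integral_mono integrable_norm ZYZY_int that)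
        have "norm (y u) * norm (y v) \<le> 2 * 2" for u v
          by (intro mult_mono y2) auto
        then show "norm (Z k w * cnj (Z k w) * (y (p k w) * cnj (y (p k w)))) \<le> 2 * 2" for w
          by (simp add: norm_mult Z1)
      qed simp
      finally show ?thesis using complex_Re_le_cmod[of "F k k"] by (simp add: prob_space)
    qed
    then have "Re (\<Sum>k\<in>Lv. F k k) \<le> real (card Lv) * 4"
      unfolding Re_sum by (intro sum_bounded_above)
    then show ?thesis by (simp add: Lv)
  qed
  \<comment> \<open>The contribution of \<open>- 2 ^ d\<close> is nonpositive and is
    dropped.\<close>
  moreover have "(norm \<mu>)\<^sup>2 * (expectation (\<lambda>w. (norm (T d w))\<^sup>2) - 2 ^ d)
      \<le> (norm \<mu>)\<^sup>2 * expectation (\<lambda>w. (norm (T d w))\<^sup>2)"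
    by (intro mult_left_mono) auto
  ultimately show ?thesis by simp
qed

text \<open>The recursion is solved by
  \<open>t d \<le> 4 ^ d * ((1 + 2 * real d) * r\<^sup>2 ^ d)\<close>: \<open>4 * r\<^sup>2\<close>
  bounds \<open>(norm \<mu>)\<^sup>2\<close>, and \<open>1 / 2 \<le> r\<^sup>2\<close> lets each
  inhomogeneous term \<open>4 * 2 ^ d\<close> raise the linear factor by just 2.\<close>

lemma path_average_second_moment:
  fixes a b :: "real \<Rightarrow> complex" and p :: "nat \<Rightarrow> 'a \<Rightarrow> real"
  assumes indep: "indep_vars (\<lambda>_. borel) p {1..<2 ^ n}"
    and "a \<in> borel_measurable borel" "b \<in> borel_measurable borel"
    and "\<And>x. norm (a x) = 1" "\<And>x. norm (b x) = 1"
    and "\<And>k. k \<in> {1..<2 ^ n} \<Longrightarrow> expectation (\<lambda>w. a (p k w) + b (p k w)) = \<mu>"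
    and r: "norm \<mu> \<le> 2 * r" "1 / 2 \<le> r\<^sup>2"
  shows "expectation (\<lambda>w. (norm ((\<Sum>k\<in>{2 ^ n..<2 ^ Suc n}. path_prod a b (\<lambda>i. p i w) k) / 2 ^ n))\<^sup>2)
      \<le> (1 + 2 * real n) * r\<^sup>2 ^ n"
proof -
  define t where "t d = expectation (\<lambda>w. (norm (\<Sum>k\<in>{2 ^ d..<2 ^ Suc d}. path_prod a b (\<lambda>i. p i w) k))\<^sup>2)" for d
  have step: "t (Suc d) \<le> 4 * 2 ^ d + (norm \<mu>)\<^sup>2 * t d" if "d < n" for d
    unfolding t_def using path_sum_second_moment_step[OF indep that] assms(2-6) by blast
  have "t d \<le> 4 ^ d * ((1 + 2 * real d) * r\<^sup>2 ^ d)" if "d \<le> n" for d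
    using that
  proof (induction d)
    case 0
    have "{Suc 0..<2} = {1}" by auto
    then show ?case by (simp add: t_def prob_space)
  next
    case (Suc d)
    have "t d \<ge> 0" unfolding t_def by simp
    have mu: "(norm \<mu>)\<^sup>2 \<le> 4 * r\<^sup>2"
      using power_mono[OF r(1), of 2] by (simp add: power_mult_distrib)
    \<comment> \<open>The bound \<open>1 / 2 \<le> r\<^sup>2\<close> enters twice: it absorbs
      \<open>(1 / 2) ^ d\<close> into \<open>r\<^sup>2 ^ d\<close>, and as
      \<open>1 \<le> 2 * r\<^sup>2\<close> it supplies the exponent \<open>Suc d\<close>.\<close>
    have "(2::real) ^ d = 4 ^ d * (1 / 2) ^ d"
      using power_mult_distrib[of "4::real" "1 / 2" d] by simp
    also have "\<dots> \<le> 4 ^ d * r\<^sup>2 ^ d"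
      using r(2) by (intro mult_left_mono power_mono) auto
    also have "\<dots> \<le> 4 ^ d * (2 * r\<^sup>2 * r\<^sup>2 ^ d)"
      using mult_right_mono[of 1 "2 * r\<^sup>2" "r\<^sup>2 ^ d"] r(2) by (intro mult_left_mono) auto
    finally have "4 * 2 ^ d \<le> 4 ^ Suc d * (2 * r\<^sup>2 ^ Suc d)" by (simp add: mult_ac)
    moreover have "(norm \<mu>)\<^sup>2 * t d \<le> 4 * r\<^sup>2 * (4 ^ d * ((1 + 2 * real d) * r\<^sup>2 ^ d))"
      using Suc mu \<open>t d \<ge> 0\<close> by (intro mult_mono) auto
    ultimately have "t (Suc d) \<le> 4 ^ Suc d * (2 * r\<^sup>2 ^ Suc d) + 4 * r\<^sup>2 * (4 ^ d * ((1 + 2 * real d) * r\<^sup>2 ^ d))"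
      using step[OF Suc_le_lessD[OF Suc.prems]] by linarith
    also have "\<dots> = 4 ^ Suc d * ((1 + 2 * real (Suc d)) * r\<^sup>2 ^ Suc d)"
      by (simp add: algebra_simps)
    finally show ?case .
  qed
  then have "t n / 4 ^ n \<le> (1 + 2 * real n) * r\<^sup>2 ^ n"
    by (simp add: divide_le_eq mult.commute)
  moreover have "(4::real) ^ n = (2 ^ n)\<^sup>2"
    using power_mult[of "2::real" 2 n] power_mult[of "2::real" n 2] by (simp add: mult.commute)
  ultimately show ?thesis
    by (simp add: t_def norm_divide norm_power power_divide)
qed

end

section \<open>Equidistribution of significands\<close>

lemma (in prob_space) expectation_le_sqrt_second_moment:
  fixes X :: "'a \<Rightarrow> real"
  assumes "integrable M X" "integrable M (\<lambda>w. (X w)\<^sup>2)"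
  shows "expectation X \<le> sqrt (expectation (\<lambda>w. (X w)\<^sup>2))"
  using variance_positive[of X] variance_eq[OF assms] by (intro real_le_rsqrt) simp

lemma (in prob_space) integrable_average_deviation:
  fixes u :: "'i \<Rightarrow> 'a \<Rightarrow> real"
  assumes h: "trig_poly h" and u: "\<And>k. k \<in> I \<Longrightarrow> u k \<in> borel_measurable M"
  shows "integrable M (\<lambda>w. (\<Sum>k\<in>I. h (u k w)) / of_nat (card I) - c)"
proof -
  obtain C where C: "\<And>x. cmod (h x) \<le> C" using trig_poly_bounded[OF h] by blast
  have "integrable M (\<lambda>w. h (u k w))" if "k \<in> I" for k
    using measurable_compose[OF u[OF that] trig_poly_measurable[OF h]] C
    by (intro integrable_const_bound[where B = C]) auto
  then have "integrable M (\<lambda>w. \<Sum>k\<in>I. h (u k w))" by (rule Bochner_Integration.integrable_sum)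
  then show ?thesis by simp
qed

text \<open>Induction over the polynomial. A constant monomial has no deviation. A monomial with
  \<open>l \<noteq> 0\<close> has integral 0, and the mean modulus of its average is at most the
  root of the second moment. Sums follow from the triangle inequality.\<close>

lemma weyl_trig_poly:
  fixes M :: "nat \<Rightarrow> 'a measure" and I :: "nat \<Rightarrow> 'i set" and u :: "nat \<Rightarrow> 'i \<Rightarrow> 'a \<Rightarrow> real"
  assumes prob: "\<And>N. prob_space (M N)"
    and I: "\<And>N. finite (I N)" "\<And>N. I N \<noteq> {}"
    and u: "\<And>N k. k \<in> I N \<Longrightarrow> u N k \<in> borel_measurable (M N)"
    and second: "\<And>l::int. l \<noteq> 0 \<Longrightarrow>
      (\<lambda>N. \<integral>w. (cmod ((\<Sum>k\<in>I N. cis (2 * pi * of_int l * u N k w)) / of_nat (card (I N))))\<^sup>2 \<partial>M N) \<longlonglongrightarrow> 0"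
    and h: "trig_poly h"
  shows "(\<lambda>N. \<integral>w. cmod ((\<Sum>k\<in>I N. h (u N k w)) / of_nat (card (I N)) - integral {0..1} h) \<partial>M N) \<longlonglongrightarrow> 0"
  using h
proof induction
  case (monom c l)
  show ?case
  proof (cases "l = 0")
    case True
    then show ?thesis using I by simp
  next
    case False
    define A where "A N w = cmod ((\<Sum>k\<in>I N. cis (2 * pi * of_int l * u N k w)) / of_nat (card (I N)))" for N w
    have A_le: "(\<integral>w. A N w \<partial>M N) \<le> sqrt (\<integral>w. (A N w)\<^sup>2 \<partial>M N)" for N
    proof -
      interpret prob_space "M N" by (rule prob)
      have "trig_poly (\<lambda>x. cis (2 * pi * of_int l * x))" using trig_poly.monom[of 1 l] by simp
      from integrable_average_deviation[OF this u, where c = 0]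
      have "integrable (M N) (\<lambda>w. (\<Sum>k\<in>I N. cis (2 * pi * of_int l * u N k w)) / of_nat (card (I N)))"
        by simp
      then have int: "integrable (M N) (A N)" unfolding A_def by (rule integrable_norm)
      have A1: "A N w \<le> 1" for w
      proof -
        have "cmod (\<Sum>k\<in>I N. cis (2 * pi * of_int l * u N k w)) \<le> of_nat (card (I N))"
          using sum_norm_le[of "I N" "\<lambda>k. cis (2 * pi * of_int l * u N k w)" "\<lambda>_. 1"] by simp
        then show ?thesis
          using I[of N] by (simp add: A_def norm_divide divide_le_eq card_gt_0_iff)
      qed
      have "(\<lambda>w. (A N w)\<^sup>2) \<in> borel_measurable (M N)"
        using int by (intro borel_measurable_power borel_measurable_integrable)
      moreover have "(A N w)\<^sup>2 \<le> 1" for w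
        using A1[of w] by (intro power_le_one) (auto simp: A_def)
      ultimately have "integrable (M N) (\<lambda>w. (A N w)\<^sup>2)"
        by (intro integrable_const_bound[where B = 1]) auto
      with int show ?thesis by (rule expectation_le_sqrt_second_moment)
    qed
    have "(\<lambda>N. sqrt (\<integral>w. (A N w)\<^sup>2 \<partial>M N)) \<longlonglongrightarrow> sqrt 0"
      unfolding A_def by (intro tendsto_real_sqrt second False)
    then have "(\<lambda>N. \<integral>w. A N w \<partial>M N) \<longlonglongrightarrow> 0"
      unfolding real_sqrt_zero
      by (rule Lim_null_comparison[rotated]) (use A_le in \<open>simp add: A_def\<close>)
    then have "(\<lambda>N. \<integral>w. cmod c * A N w \<partial>M N) \<longlonglongrightarrow> 0"
      using tendsto_mult_right_zero[of _ sequentially "cmod c"] by simp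
    moreover have "cmod ((\<Sum>k\<in>I N. c * cis (2 * pi * of_int l * u N k w)) / of_nat (card (I N))) = cmod c * A N w" for N w
      by (simp add: A_def norm_divide norm_mult sum_distrib_left[symmetric])
    ultimately show ?thesis
      by (simp only: integral_trig_monom[OF False] diff_zero)
  qed
next
  case (add g h)
  define D where "D f N w = cmod ((\<Sum>k\<in>I N. f (u N k w)) / of_nat (card (I N)) - integral {0..1} f)"
    for f :: "real \<Rightarrow> complex" and N w
  have int: "integrable (M N) (D f N)" if "trig_poly f" for f N
    unfolding D_def by (intro integrable_norm prob_space.integrable_average_deviation prob that u)
  have gh: "trig_poly (\<lambda>x. g x + h x)" using add.hyps by (rule trig_poly.add)
  have "D (\<lambda>x. g x + h x) N w \<le> D g N w + D h N w" for N w
  proof -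
    have "integral {0..1} (\<lambda>x. g x + h x) = integral {0..1} g + integral {0..1} h"
      using add.hyps by (intro integral_add integrable_continuous_real trig_poly_continuous_on)
    then have "(\<Sum>k\<in>I N. g (u N k w) + h (u N k w)) / of_nat (card (I N)) - integral {0..1} (\<lambda>x. g x + h x)
      = ((\<Sum>k\<in>I N. g (u N k w)) / of_nat (card (I N)) - integral {0..1} g)
      + ((\<Sum>k\<in>I N. h (u N k w)) / of_nat (card (I N)) - integral {0..1} h)"
      by (simp add: sum.distrib add_divide_distrib)
    then show ?thesis unfolding D_def by (simp only: norm_triangle_ineq)
  qed
  then have "(\<integral>w. D (\<lambda>x. g x + h x) N w \<partial>M N) \<le> (\<integral>w. D g N w + D h N w \<partial>M N)" for N
    by (intro integral_mono Bochner_Integration.integrable_add int gh add.hyps)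
  then have le: "(\<integral>w. D (\<lambda>x. g x + h x) N w \<partial>M N) \<le> (\<integral>w. D g N w \<partial>M N) + (\<integral>w. D h N w \<partial>M N)" for N
    by (simp add: int add.hyps)
  have "(\<lambda>N. (\<integral>w. D g N w \<partial>M N) + (\<integral>w. D h N w \<partial>M N)) \<longlonglongrightarrow> 0"
    using tendsto_add[OF add.IH] by (simp add: D_def)
  then have "(\<lambda>N. \<integral>w. D (\<lambda>x. g x + h x) N w \<partial>M N) \<longlonglongrightarrow> 0"
    by (rule Lim_null_comparison[rotated]) (use le in \<open>simp add: D_def\<close>)
  then show ?case by (simp add: D_def)
qed

text \<open>Volumes are positive only almost surely, so measurability is needed on the whole line.
  For \<open>x > 0\<close> the function is the indicator of a countable union of intervals; for
  \<open>x \<le> 0\<close> it is constant.\<close>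

lemma phi_measurable [measurable]:
  assumes "s \<in> {1..<10}"
  shows "phi s \<in> borel_measurable borel"
proof -
  have pos: "phi s x = indicator (\<Union>n::int. {10 powi n..s * 10 powi n}) x" if "x > 0" for x :: real
  proof -
    obtain a and n :: int where a: "1 \<le> a" "a < 10" "x = a * 10 powi n"
      using significand_ex1[OF \<open>x > 0\<close>] by blast
    have "x \<in> (\<Union>k::int. {10 powi k..s * 10 powi k}) \<longleftrightarrow> a \<le> s"
    proof
      assume "x \<in> (\<Union>k::int. {10 powi k..s * 10 powi k})"
      then obtain k :: int where k: "10 powi k \<le> x" "x \<le> s * 10 powi k" by auto
      \<comment> \<open>Here \<open>s < 10\<close> keeps the quotient below 10.\<close>
      have "significand x = x / 10 powi k"
        using k assms by (intro significand_eqI[where n = k]) (auto simp: divide_simps intro: le_less_trans)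
      with significand_eqI[OF a] have "a = x / 10 powi k" by simp
      with k(2) show "a \<le> s" by (simp add: divide_le_eq)
    qed (use a in \<open>auto intro!: exI[of _ n]\<close>)
    then show ?thesis
      using significand_eqI[OF a] by (simp add: phi_def indicator_def)
  qed
  have neg: "phi s x = phi s 0" if "x \<le> 0" for x :: real
  proof -
    \<comment> \<open>For \<open>y \<le> 0\<close> the description under \<open>THE\<close> has no
      solution, so all such \<open>y\<close> share the unspecified value
      \<open>THE a. False\<close>.\<close>
    have "y \<noteq> a * 10 powi n" if "1 \<le> a" "y \<le> 0" for a y :: real and n :: int
      using that zero_less_power_int[of "10::real" n] mult_pos_pos[of a "10 powi n"] by linarith
    then have "significand y = (THE a. False)" if "y \<le> 0" for y
      unfolding significand_def using that by (intro arg_cong[where f = The] ext) blast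
    then show ?thesis using that by (simp add: phi_def)
  qed
  have "phi s = (\<lambda>x. if x \<le> 0 then phi s 0 else indicator (\<Union>n::int. {10 powi n..s * 10 powi n}) x)"
  proof
    fix x
    show "phi s x = (if x \<le> 0 then phi s 0 else indicator (\<Union>n::int. {10 powi n..s * 10 powi n}) x)"
      using pos[of x] neg[of x] by (cases "x \<le> 0") auto
  qed
  also have "\<dots> \<in> borel_measurable borel" by measurable
  finally show ?thesis .
qed

text \<open>The logarithm of the significand is the fractional part of \<open>log 10 x\<close>; the
  form with an integer shift is the one the arc majorants accept.\<close>

lemma log_significand:
  assumes "x > 0"
  obtains n :: int where "log 10 x - of_int n = log 10 (significand x)"
    "1 \<le> significand x" "significand x < 10"
proof -
  obtain a and n :: int where a: "1 \<le> a" "a < 10" "x = a * 10 powi n"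
    using significand_ex1[OF assms] by blast
  then have "log 10 x = log 10 a + of_int n"
    by (simp add: log_mult powr_real_of_int' [symmetric])
  then show thesis
    using a significand_eqI[OF a] by (intro that[of n]) simp_all
qed

text \<open>In terms of the fractional part of the logarithm, \<open>phi s\<close> is the indicator
  of an arc of length \<open>log 10 s\<close>. A trigonometric majorant of this arc bounds the
  proportion from above; a majorant of the complementary arc, applied to \<open>1 - phi s\<close>,
  bounds it from below.\<close>

lemma weyl_significand:
  fixes M :: "nat \<Rightarrow> 'a measure" and I :: "nat \<Rightarrow> 'i set" and X :: "nat \<Rightarrow> 'i \<Rightarrow> 'a \<Rightarrow> real"
  assumes prob: "\<And>N. prob_space (M N)"
    and I: "\<And>N. finite (I N)" "\<And>N. I N \<noteq> {}"
    and X: "\<And>N k. k \<in> I N \<Longrightarrow> X N k \<in> borel_measurable (M N)"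
    and pos: "\<And>N. AE w in M N. \<forall>k\<in>I N. X N k w > 0"
    and second: "\<And>l::int. l \<noteq> 0 \<Longrightarrow>
      (\<lambda>N. \<integral>w. (cmod ((\<Sum>k\<in>I N. cis (2 * pi * of_int l * log 10 (X N k w))) / of_nat (card (I N))))\<^sup>2 \<partial>M N) \<longlonglongrightarrow> 0"
    and s: "s \<in> {1..<10}"
  shows "(\<lambda>N. \<integral>w. \<bar>(\<Sum>k\<in>I N. phi s (X N k w)) / of_nat (card (I N)) - log 10 s\<bar> \<partial>M N) \<longlonglongrightarrow> 0"
proof -
  define L where "L = log 10 s"
  have L: "0 \<le> L" "L < 1" using s by (auto simp: L_def)
  define P where "P N w = (\<Sum>k\<in>I N. phi s (X N k w)) / real (card (I N))" for N w
  define D where "D h N w = cmod ((\<Sum>k\<in>I N. complex_of_real (h (log 10 (X N k w)))) / of_nat (card (I N))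
      - integral {0..1} (\<lambda>x. complex_of_real (h x)))" for h :: "real \<Rightarrow> real" and N w
  have u: "(\<lambda>w. log 10 (X N k w)) \<in> borel_measurable (M N)" if "k \<in> I N" for N k
    using X[OF that] by measurable
  have D_int: "integrable (M N) (D h N)" if "trig_poly (\<lambda>x. complex_of_real (h x))" for h N
    unfolding D_def by (intro integrable_norm prob_space.integrable_average_deviation[OF prob that] u)
  have D_lim: "(\<lambda>N. \<integral>w. D h N w \<partial>M N) \<longlonglongrightarrow> 0" if "trig_poly (\<lambda>x. complex_of_real (h x))" for h
    unfolding D_def by (rule weyl_trig_poly[OF prob I u second that])
  \<comment> \<open>Pointwise majorization by \<open>h\<close> passes to averages, and the average
    of \<open>h\<close> exceeds its integral by at most \<open>D h N w\<close>.\<close>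
  have le_D: "(\<Sum>k\<in>I N. v k) / real (card (I N)) \<le> D h N w + B"
    if "trig_poly (\<lambda>x. complex_of_real (h x))" "integral {0..1} h \<le> B"
      "\<And>k. k \<in> I N \<Longrightarrow> v k \<le> h (log 10 (X N k w))" for h N w B and v :: "'i \<Rightarrow> real"
  proof -
    define S where "S = (\<Sum>k\<in>I N. h (log 10 (X N k w))) / real (card (I N))"
    have "continuous_on {0..1} (\<lambda>x. Re (complex_of_real (h x)))"
      using that(1) by (intro continuous_on_Re trig_poly_continuous_on)
    then have "(h has_integral integral {0..1} h) {0..1}"
      by (simp add: integrable_integral integrable_continuous_real)
    then have "integral {0..1} (\<lambda>x. complex_of_real (h x)) = complex_of_real (integral {0..1} h)"
      by (intro integral_unique has_integral_of_real)
    then have "D h N w = cmod (complex_of_real (S - integral {0..1} h))"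
      by (simp add: D_def S_def)
    then have "D h N w = \<bar>S - integral {0..1} h\<bar>"
      by (simp only: norm_of_real)
    then have "S \<le> D h N w + B"
      using that(2) by linarith
    moreover have "(\<Sum>k\<in>I N. v k) / real (card (I N)) \<le> S"
      unfolding S_def using that(3) by (intro divide_right_mono sum_mono) auto
    ultimately show ?thesis by linarith
  qed
  have "\<forall>\<^sub>F N in sequentially. (\<integral>w. \<bar>P N w - L\<bar> \<partial>M N) < \<epsilon>" if \<epsilon>: "\<epsilon> > 0" for \<epsilon>
  proof -
    \<comment> \<open>The closed arcs \<open>{0..L}\<close> and \<open>{L..1}\<close> cover the
      circle; the integrals of \<open>h\<close> and \<open>g\<close> exceed the arc lengths by at
      most \<open>\<epsilon> / 2\<close> each.\<close>
    obtain h where h: "trig_poly (\<lambda>x. complex_of_real (h x))" "\<And>x. 0 \<le> h x"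
      "\<And>x n. x - of_int n \<in> {0..L} \<Longrightarrow> 1 \<le> h x" "integral {0..1} h \<le> L - 0 + \<epsilon> / 2"
      using arc_trig_poly_upper[of 0 L "\<epsilon> / 2"] L \<epsilon> by auto
    obtain g where g: "trig_poly (\<lambda>x. complex_of_real (g x))" "\<And>x. 0 \<le> g x"
      "\<And>x n. x - of_int n \<in> {L..1} \<Longrightarrow> 1 \<le> g x" "integral {0..1} g \<le> 1 - L + \<epsilon> / 2"
      using arc_trig_poly_upper[of L 1 "\<epsilon> / 2"] L \<epsilon> by auto
    have sandwich: "phi s x \<le> h (log 10 x)" "1 - phi s x \<le> g (log 10 x)" if x: "x > 0" for x
    proof -
      obtain n where n: "log 10 x - of_int n = log 10 (significand x)"
        "1 \<le> significand x" "significand x < 10"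
        using log_significand[OF x] by blast
      then have in01: "0 \<le> log 10 (significand x)" "log 10 (significand x) \<le> 1" by auto
      have iff: "significand x \<le> s \<longleftrightarrow> log 10 (significand x) \<le> L"
        using n s by (simp add: L_def)
      show "phi s x \<le> h (log 10 x)"
        using h(2)[of "log 10 x"] h(3)[of "log 10 x" n] n(1) in01 iff by (auto simp: phi_def)
      show "1 - phi s x \<le> g (log 10 x)"
        using g(2)[of "log 10 x"] g(3)[of "log 10 x" n] n(1) in01 iff by (auto simp: phi_def)
    qed
    have bound: "(\<integral>w. \<bar>P N w - L\<bar> \<partial>M N) \<le> (\<integral>w. D h N w \<partial>M N) + (\<integral>w. D g N w \<partial>M N) + \<epsilon> / 2" for N
    proof -
      interpret prob_space "M N" by (rule prob)
      have "AE w in M N. \<bar>P N w - L\<bar> \<le> D h N w + D g N w + \<epsilon> / 2"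
        using pos[of N]
      proof eventually_elim
        case (elim w)
        have "P N w \<le> D h N w + (L - 0 + \<epsilon> / 2)"
          unfolding P_def using elim by (intro le_D h sandwich) auto
        \<comment> \<open>This average is \<open>1 - P N w\<close>, so its upper bound reads
          \<open>L - P N w \<le> D g N w + \<epsilon> / 2\<close>.\<close>
        moreover have "(\<Sum>k\<in>I N. 1 - phi s (X N k w)) / real (card (I N)) \<le> D g N w + (1 - L + \<epsilon> / 2)"
          using elim by (intro le_D g sandwich) auto
        moreover have "(\<Sum>k\<in>I N. 1 - phi s (X N k w)) / real (card (I N)) = 1 - P N w"
          using I[of N] by (simp add: P_def sum_subtractf diff_divide_distrib)
        moreover have "D h N w \<ge> 0" "D g N w \<ge> 0" by (simp_all add: D_def)
        ultimately show ?case by linarith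
      qed
      moreover have int: "integrable (M N) (\<lambda>w. D h N w + D g N w + \<epsilon> / 2)"
        using D_int[OF h(1)] D_int[OF g(1)] by simp
      ultimately have "(\<integral>w. \<bar>P N w - L\<bar> \<partial>M N) \<le> (\<integral>w. D h N w + D g N w + \<epsilon> / 2 \<partial>M N)"
        by (intro integral_mono_AE') auto
      also have "\<dots> = (\<integral>w. D h N w \<partial>M N) + (\<integral>w. D g N w \<partial>M N) + \<epsilon> / 2"
        using D_int[OF h(1), of N] D_int[OF g(1), of N] by (simp add: prob_space)
      finally show ?thesis .
    qed
    have "(\<lambda>N. (\<integral>w. D h N w \<partial>M N) + (\<integral>w. D g N w \<partial>M N)) \<longlonglongrightarrow> 0"
      using tendsto_add[OF D_lim[OF h(1)] D_lim[OF g(1)]] by simp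
    then have "\<forall>\<^sub>F N in sequentially. (\<integral>w. D h N w \<partial>M N) + (\<integral>w. D g N w \<partial>M N) < \<epsilon> / 2"
      using \<epsilon> by (intro order_tendstoD) auto
    then show ?thesis
    proof eventually_elim
      case (elim N)
      with bound[of N] show ?case by linarith
    qed
  qed
  then have "(\<lambda>N. \<integral>w. \<bar>P N w - L\<bar> \<partial>M N) \<longlonglongrightarrow> 0"
    by (intro tendstoI) (simp add: abs_of_nonneg)
  then show ?thesis by (simp add: P_def L_def)
qed

text \<open>For values in \<open>{0..1}\<close> the squared deviation from the mean is at most the
  absolute one, hence at most \<open>\<bar>P N w - c\<bar> + \<bar>E N - c\<bar>\<close>; each of
  the two terms has integral at most the mean distance to \<open>c\<close>.\<close>

lemma L1_limit_imp_mean_variance: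
  fixes M :: "nat \<Rightarrow> 'a measure" and P :: "nat \<Rightarrow> 'a \<Rightarrow> real"
  assumes prob: "\<And>N. prob_space (M N)"
    and P: "\<And>N. P N \<in> borel_measurable (M N)" "\<And>N w. P N w \<in> {0..1}"
    and lim: "(\<lambda>N. \<integral>w. \<bar>P N w - c\<bar> \<partial>M N) \<longlonglongrightarrow> 0"
  shows "(\<lambda>N. prob_space.expectation (M N) (P N)) \<longlonglongrightarrow> c"
    and "(\<lambda>N. prob_space.variance (M N) (P N)) \<longlonglongrightarrow> 0"
proof -
  define E where "E N = (\<integral>w. P N w \<partial>M N)" for N
  define A where "A N = (\<integral>w. \<bar>P N w - c\<bar> \<partial>M N)" for N
  have bounds: "\<bar>E N - c\<bar> \<le> A N" "prob_space.variance (M N) (P N) \<le> 2 * A N" for N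
  proof -
    interpret prob_space "M N" by (rule prob)
    have int: "integrable (M N) (P N)"
      using P by (intro integrable_const_bound[where B = 1]) auto
    have "E N - c = (\<integral>w. P N w - c \<partial>M N)"
      using int by (simp add: E_def prob_space)
    then show E: "\<bar>E N - c\<bar> \<le> A N"
      unfolding A_def using integral_abs_bound[of "M N" "\<lambda>w. P N w - c"] by simp
    have "0 \<le> E N" "E N \<le> 1"
      unfolding E_def using P(2) int by (auto intro!: integral_nonneg_AE integral_le_const)
    then have "(P N w - E N)\<^sup>2 \<le> \<bar>P N w - c\<bar> + \<bar>E N - c\<bar>" for w
    proof -
      have "\<bar>P N w - E N\<bar> \<le> 1" using P(2)[of N w] \<open>0 \<le> E N\<close> \<open>E N \<le> 1\<close> by auto
      then have "\<bar>P N w - E N\<bar> * \<bar>P N w - E N\<bar> \<le> \<bar>P N w - E N\<bar> * 1"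
        by (intro mult_left_mono) auto
      then have "(P N w - E N)\<^sup>2 \<le> \<bar>P N w - E N\<bar>" by (simp add: power2_eq_square)
      then show ?thesis by linarith
    qed
    then have "variance (P N) \<le> (\<integral>w. \<bar>P N w - c\<bar> + \<bar>E N - c\<bar> \<partial>M N)"
      unfolding E_def using int by (intro integral_mono') auto
    also have "\<dots> = A N + \<bar>E N - c\<bar>"
      using int by (simp add: A_def prob_space)
    finally show "variance (P N) \<le> 2 * A N" using E by simp
  qed
  have A: "A \<longlonglongrightarrow> 0" using lim unfolding A_def[abs_def] .
  have "(\<lambda>N. E N - c) \<longlonglongrightarrow> 0"
    by (rule Lim_null_comparison[OF _ A]) (simp add: bounds)
  then show "(\<lambda>N. prob_space.expectation (M N) (P N)) \<longlonglongrightarrow> c"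
    by (simp add: E_def LIM_zero_iff)
  have "(\<lambda>N. 2 * A N) \<longlonglongrightarrow> 0"
    using A by (rule tendsto_mult_right_zero)
  then show "(\<lambda>N. prob_space.variance (M N) (P N)) \<longlonglongrightarrow> 0"
    by (rule Lim_null_comparison[rotated]) (simp add: bounds prob_space.variance_positive[OF prob])
qed

section \<open>The fragmentation process\<close>

lemma cont_prob_density01_measurable:
  assumes "cont_prob_density01 f"
  shows "f \<in> borel_measurable borel"
proof -
  have "(\<lambda>t. indicator {0<..<1} t *\<^sub>R f t) \<in> borel_measurable borel"
    using assms by (intro borel_measurable_continuous_on_indicator) (auto simp: cont_prob_density01_def)
  also have "(\<lambda>t. indicator {0<..<1} t *\<^sub>R f t) = f"
  proof
    fix t
    show "indicator {0<..<1} t *\<^sub>R f t = f t"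
      using assms by (cases "t \<in> {0<..<1}") (auto simp: cont_prob_density01_def)
  qed
  finally show ?thesis .
qed

lemma (in prob_space) expectation_density01:
  fixes g :: "real \<Rightarrow> complex"
  assumes f: "cont_prob_density01 f" and X: "distributed M lborel X (\<lambda>t. ennreal (f t))"
    and [measurable]: "g \<in> borel_measurable borel"
  shows "expectation (\<lambda>w. g (X w)) = (\<integral>t. f t *\<^sub>R g t \<partial>lborel)"
proof -
  have nonneg: "0 \<le> f t" for t using f by (cases "t \<in> {0<..<1}") (auto simp: cont_prob_density01_def)
  have "expectation (\<lambda>w. g (X w)) = (\<integral>t. g t \<partial>distr M lborel X)"
    by (rule integral_distr[symmetric, OF distributed_measurable[OF X]]) simp
  also have "\<dots> = (\<integral>t. g t \<partial>density lborel (\<lambda>t. ennreal (f t)))"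
    by (simp add: distributed_distr_eq_density[OF X])
  also have "\<dots> = (\<integral>t. f t *\<^sub>R g t \<partial>lborel)"
    using cont_prob_density01_measurable[OF f] nonneg by (subst integral_density) auto
  finally show ?thesis .
qed

text \<open>The density vanishes off the open unit interval. This makes all edge weights positive
  almost surely, so that logarithms of path products split.\<close>

lemma (in prob_space) AE_density01:
  assumes f: "cont_prob_density01 f" and X: "distributed M lborel X (\<lambda>t. ennreal (f t))"
  shows "AE w in M. X w \<in> {0<..<1}"
proof -
  have [measurable]: "(\<lambda>t. ennreal (f t)) \<in> borel_measurable lborel"
    using cont_prob_density01_measurable[OF f] by simp
  have "AE t in density lborel (\<lambda>t. ennreal (f t)). t \<in> {0<..<1}"
  proof (subst AE_density)
    have "t \<in> {0<..<1}" if "0 < f t" for t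
      using f that unfolding cont_prob_density01_def by (metis less_irrefl)
    then show "AE t in lborel. 0 < ennreal (f t) \<longrightarrow> t \<in> {0<..<1}"
      by (intro AE_I2) (simp only: ennreal_less_zero_iff, blast)
  qed measurable
  then have "AE t in distr M lborel X. t \<in> {0<..<1}"
    by (simp only: distributed_distr_eq_density[OF X])
  then show ?thesis
    using distributed_measurable[OF X] by (rule AE_distrD[rotated])
qed

text \<open>On the line with real part 1 the kernel \<open>t powr s / t\<close> has modulus 1; at
  this \<open>s\<close> it equals \<open>exp (\<i> * \<alpha> * ln t)\<close>, the character at
  \<open>log 10 t\<close>. The index \<open>- l\<close> keeps the argument in the shape of the
  Mellin hypothesis.\<close>

lemma mellin_eq_character_mean:
  assumes f: "cont_prob_density01 f"
  shows "(\<integral>t. f t *\<^sub>R cis (2 * pi * of_int l * log 10 t) \<partial>lborel)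
    = mellin f (1 - 2 * complex_of_real pi * \<i> * of_int (- l) / complex_of_real (ln 10))"
  unfolding mellin_def set_lebesgue_integral_def
proof (rule Bochner_Integration.integral_cong[OF refl])
  fix t :: real
  show "f t *\<^sub>R cis (2 * pi * of_int l * log 10 t) = indicator {0<..} t *\<^sub>R
     (complex_of_real (f t) * complex_of_real t powr
       (1 - 2 * complex_of_real pi * \<i> * of_int (- l) / complex_of_real (ln 10)) / complex_of_real t)"
  proof (cases "t \<in> {0<..<1}")
    case True
    define \<alpha> where "\<alpha> = 2 * pi * of_int l / ln 10"
    have "complex_of_real t powr (1 - 2 * complex_of_real pi * \<i> * of_int (- l) / complex_of_real (ln 10))
        = exp ((1 + \<i> * \<alpha>) * complex_of_real (ln t))"
      using True by (simp add: powr_def Ln_of_real \<alpha>_def mult_ac)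
    also have "\<dots> = complex_of_real t * exp (\<i> * complex_of_real (\<alpha> * ln t))"
      using True by (simp add: distrib_left distrib_right exp_add exp_of_real mult_ac)
    also have "exp (\<i> * complex_of_real (\<alpha> * ln t)) = cis (2 * pi * of_int l * log 10 t)"
      by (simp add: cis_conv_exp \<alpha>_def log_def)
    finally show ?thesis
      using True by (simp add: scaleR_conv_of_real)
  qed (use f in \<open>auto simp: cont_prob_density01_def\<close>)
qed

text \<open>If \<open>1 \<le> cmod (g l)\<close>, the single term at \<open>l\<close> would keep
  every sum at least 1. For \<open>g\<close> given by the Mellin transform of \<open>f\<close>, this
  turns the summed hypothesis into a strict inequality at each nonzero frequency.\<close>

lemma norm_less_1_of_power_sums_tendsto_0:
  assumes "1 \<le> m"
    and lim: "(\<lambda>N. \<Sum>\<^sub>\<infinity>l\<in>UNIV - {0::int}. ennreal (cmod (\<Prod>u=1..N * m. g l))) \<longlonglongrightarrow> 0"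
    and "l \<noteq> 0"
  shows "cmod (g l) < 1"
proof (rule ccontr)
  assume "\<not> cmod (g l) < 1"
  then have ge: "1 \<le> cmod (g l) ^ n" for n by (simp add: one_le_power)
  have "\<forall>\<^sub>F N in sequentially. (\<Sum>\<^sub>\<infinity>l\<in>UNIV - {0::int}. ennreal (cmod (\<Prod>u=1..N * m. g l))) < 1"
    using lim by (rule order_tendstoD) simp
  then obtain N where N: "(\<Sum>\<^sub>\<infinity>l\<in>UNIV - {0::int}. ennreal (cmod (\<Prod>u=1..N * m. g l))) < 1"
    by (meson eventually_sequentially order_refl)
  have "1 \<le> ennreal (cmod (\<Prod>u=1..N * m. g l))"
    using ge[of "N * m"] by (simp add: norm_power)
  also have "\<dots> = (\<Sum>\<^sub>\<infinity>l\<in>{l}. ennreal (cmod (\<Prod>u=1..N * m. g l)))"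
    by simp
  also have "\<dots> \<le> (\<Sum>\<^sub>\<infinity>l\<in>UNIV - {0::int}. ennreal (cmod (\<Prod>u=1..N * m. g l)))"
    using \<open>l \<noteq> 0\<close> by (intro infsum_mono_neutral nonneg_summable_on_complete) auto
  also note N
  finally show False by simp
qed

section \<open>Characters and pieces along the tree\<close>

lemma tree_weight_path_prod: "tree_weight x k = path_prod (\<lambda>t. t) (\<lambda>t. 1 - t) x k"
  by (induction k rule: less_induct) (subst tree_weight.simps, subst path_prod.simps, simp)

text \<open>The logarithm turns the product along the path into a sum, and \<open>cis\<close> turns
  the sum back into a product. Splitting the logarithm requires positive factors, so positivity is
  carried through the same induction.\<close>

lemma character_tree_weight:
  assumes "\<And>i. i \<in> {1..<n} \<Longrightarrow> x i \<in> {0<..<1}" "k < 2 * n"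
  shows "tree_weight x k > 0 \<and> cis (\<alpha> * log 10 (tree_weight x k))
    = path_prod (\<lambda>t. cis (\<alpha> * log 10 t)) (\<lambda>t. cis (\<alpha> * log 10 (1 - t))) x k"
  using assms(2)
proof (induction k rule: less_induct)
  case (less k)
  show ?case
  proof (cases "k \<le> 1")
    case True
    then show ?thesis by (simp add: path_prod.simps tree_weight.simps)
  next
    case False
    define j where "j = k div 2"
    have "j < k" "j < 2 * n" "j \<in> {1..<n}" using False less.prems by (auto simp: j_def)
    then have IH: "tree_weight x j > 0" "cis (\<alpha> * log 10 (tree_weight x j))
        = path_prod (\<lambda>t. cis (\<alpha> * log 10 t)) (\<lambda>t. cis (\<alpha> * log 10 (1 - t))) x j"
      and xj: "0 < x j" "x j < 1"
      using less.IH assms(1)[of j] by auto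
    have mult: "cis (\<alpha> * log 10 (u * v)) = cis (\<alpha> * log 10 u) * cis (\<alpha> * log 10 v)"
      if "u > 0" "v > 0" for u v
      using that by (simp add: log_mult distrib_left cis_mult)
    have "tree_weight x k = tree_weight x j * (if even k then x j else 1 - x j)"
      using False by (simp add: tree_weight.simps[of _ k] j_def)
    moreover have "path_prod a b x k = path_prod a b x j * (if even k then a (x j) else b (x j))"
      for a b :: "real \<Rightarrow> complex"
      using False by (simp add: path_prod.simps[of _ _ _ k] j_def)
    ultimately show ?thesis
      using IH xj by (simp add: mult)
  qed
qed

lemma frac_pieces_tree:
  "frac_pieces m x B N s =
    (\<Sum>k\<in>{2 ^ (N * m)..<2 ^ Suc (N * m)}. phi s (box_volume m B * tree_weight x k)) / 2 ^ (N * m)"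
proof -
  \<comment> \<open>Polymorphic, because it rewrites both the natural upper limit of the sum and the
    real denominator.\<close>
  have pow: "(2 ^ m) ^ N = (2 ^ (N * m) :: 'b::comm_semiring_1)" by (simp add: power_mult[symmetric] mult.commute)
  have "(\<Sum>i=1..2 ^ (N * m). phi s (piece_volume m x B N i))
      = (\<Sum>k\<in>{2 ^ (N * m)..<2 ^ Suc (N * m)}. phi s (box_volume m B * tree_weight x k))"
    \<comment> \<open>Piece \<open>i\<close>, counted from 1, is the leaf
      \<open>2 ^ (N * m) + i - 1\<close>.\<close>
    by (rule sum.reindex_bij_witness[where i = "\<lambda>k. k - 2 ^ (N * m) + 1" and j = "\<lambda>i. 2 ^ (N * m) + i - 1"])
       (auto simp: piece_volume_eq)
  then show ?thesis by (simp add: frac_pieces_def pow)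
qed

lemma frac_pieces_bounds: "frac_pieces m x B N s \<in> {0..1}"
proof -
  have "(\<Sum>i=1..(2 ^ m) ^ N. phi s (piece_volume m x B N i)) \<le> of_nat (card {1..(2 ^ m) ^ N :: nat}) * 1"
    by (intro sum_bounded_above) (simp add: phi_def)
  then show ?thesis
    by (auto simp: frac_pieces_def phi_def divide_le_eq intro!: divide_nonneg_nonneg sum_nonneg)
qed

theorem theorem1p9:
  fixes m :: nat and V :: real and f :: "real \<Rightarrow> real"
    and B :: cbounds
    and M :: "nat \<Rightarrow> 'a measure"
    and p :: "nat \<Rightarrow> nat \<Rightarrow> 'a \<Rightarrow> real"
  assumes "1 \<le> m" and "0 < V"
    and "cont_prob_density01 f"
    and "\<And>fs :: nat \<Rightarrow> real \<Rightarrow> real.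
           (\<forall>u\<ge>1. fs u = f \<or> fs u = (\<lambda>t. f (1 - t))) \<Longrightarrow>
           (\<lambda>N. \<Sum>\<^sub>\<infinity>l\<in>UNIV - {0::int}.
              ennreal (cmod (\<Prod>u=1..N * m.
                mellin (fs u) (1 - 2 * complex_of_real pi * \<i> * of_int l / complex_of_real (ln 10)))))
           \<longlonglongrightarrow> 0"
    and "is_box m B" and "box_volume m B = V"
    and "\<And>N. prob_space (M N)"
    and "\<And>N. prob_space.indep_vars (M N) (\<lambda>_. borel) (p N) {1..2 ^ (N * m) - 1}"
    and "\<And>N k. k \<in> {1..2 ^ (N * m) - 1} \<Longrightarrow>
           distributed (M N) lborel (p N k) (\<lambda>t. ennreal (f t))"
    and "s \<in> {1..<10::real}"
  shows "(\<lambda>N. prob_space.expectation (M N) (\<lambda>\<omega>. frac_pieces m (\<lambda>k. p N k \<omega>) B N s))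
           \<longlonglongrightarrow> log 10 s
       \<and> (\<lambda>N. prob_space.variance (M N) (\<lambda>\<omega>. frac_pieces m (\<lambda>k. p N k \<omega>) B N s))
           \<longlonglongrightarrow> 0"
proof -
  define n where "n N = N * m" for N
  define I where "I N = {2 ^ n N..<2 ^ Suc (n N) :: nat}" for N
  define X where "X N k w = V * tree_weight (\<lambda>i. p N i w) k" for N k w
  have card_I: "card (I N) = 2 ^ n N" for N by (simp add: I_def)
  have idx: "{1..2 ^ n N - 1} = {1..<2 ^ n N :: nat}" for N
    by auto
  have indep: "prob_space.indep_vars (M N) (\<lambda>_. borel) (p N) {1..<2 ^ n N}" for N
    using assms(8)[of N] by (simp only: idx n_def[symmetric])
  have dist: "distributed (M N) lborel (p N k) (\<lambda>t. ennreal (f t))" if "k \<in> {1..<2 ^ n N}" for N k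
    using assms(9)[of k N] that by (simp only: idx n_def[symmetric])
  have p_meas: "p N k \<in> borel_measurable (M N)" if "k \<in> {1..<2 ^ n N}" for N k
    using distributed_measurable[OF dist[OF that]] by simp
  have X_meas: "X N k \<in> borel_measurable (M N)" if "k \<in> I N" for N k
    unfolding X_def tree_weight_path_prod using that p_meas
    by (intro borel_measurable_times path_prod_measurable[where n = "2 ^ n N"]) (auto simp: I_def)
  \<comment> \<open>Only finitely many proportions occur for each \<open>N\<close>, so the
    exceptional null sets combine.\<close>
  have AE_p: "AE w in M N. \<forall>k\<in>{1..<2 ^ n N}. p N k w \<in> {0<..<1}" for N
    using prob_space.AE_density01[OF assms(7) assms(3) dist] by (subst AE_finite_all) auto
  have pos: "AE w in M N. \<forall>k\<in>I N. X N k w > 0" for N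
    using AE_p[of N]
  proof eventually_elim
    case (elim w)
    show ?case
    proof
      fix k assume "k \<in> I N"
      then have "tree_weight (\<lambda>i. p N i w) k > 0"
        using character_tree_weight[of "2 ^ n N" "\<lambda>i. p N i w" k] elim by (simp add: I_def)
      then show "X N k w > 0" using \<open>0 < V\<close> by (simp add: X_def)
    qed
  qed
  have second: "(\<lambda>N. \<integral>w. (cmod ((\<Sum>k\<in>I N. cis (2 * pi * of_int l * log 10 (X N k w))) / of_nat (card (I N))))\<^sup>2 \<partial>M N) \<longlonglongrightarrow> 0"
    if l: "l \<noteq> 0" for l :: int
  proof -
    define a where "a t = cis (2 * pi * of_int l * log 10 t)" for t
    define b where "b t = a (1 - t)" for t
    define \<mu> where "\<mu> = (\<integral>t. f t *\<^sub>R (a t + b t) \<partial>lborel)"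
    have cis_meas: "cis \<in> borel_measurable borel"
      by (intro borel_measurable_continuous_onI continuous_intros)
    have a_meas [measurable]: "a \<in> borel_measurable borel"
      unfolding a_def by (rule measurable_compose[OF _ cis_meas]) measurable
    have b_meas [measurable]: "b \<in> borel_measurable borel"
      unfolding b_def by measurable
    have unit: "cmod (a t) = 1" "cmod (b t) = 1" for t by (simp_all add: a_def b_def)
    have mean: "prob_space.expectation (M N) (\<lambda>w. a (p N k w) + b (p N k w)) = \<mu>"
      if "k \<in> {1..<2 ^ n N}" for N k
      unfolding \<mu>_def by (intro prob_space.expectation_density01[OF assms(7) assms(3) dist[OF that]]) measurable
    define c where "c = cmod (\<integral>t. f t *\<^sub>R a t \<partial>lborel)"
    \<comment> \<open>The Mellin hypothesis is applied to the constant sequence \<open>f\<close> and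
      read at index \<open>- l\<close>.\<close>
    have "c < 1"
      unfolding c_def a_def mellin_eq_character_mean[OF assms(3)]
      using l assms(4)[of "\<lambda>_. f"] by (intro norm_less_1_of_power_sums_tendsto_0[OF \<open>1 \<le> m\<close>, where l = "- l"]) auto
    \<comment> \<open>Strictness for the left child suffices: the mean of \<open>b\<close> has
      modulus at most 1 trivially, so \<open>cmod \<mu>\<close> stays below 2.\<close>
    have "cmod \<mu> \<le> c + 1"
    proof -
      interpret prob_space "M 1" by (rule assms(7))
      \<comment> \<open>Since \<open>1 \<le> m\<close>, the process with \<open>N = 1\<close> has a
        proportion of index 1; its law is used to split \<open>\<mu>\<close> into two bounded
        expectations.\<close>
      have "(2::nat) ^ 1 \<le> 2 ^ n 1" using \<open>1 \<le> m\<close> unfolding n_def by (intro power_increasing) auto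
      then have 1: "1 \<in> {1..<2 ^ n 1 :: nat}" by simp
      have int: "integrable (M 1) (\<lambda>w. g (p 1 1 w))"
        if "g \<in> borel_measurable borel" and "\<And>t. cmod (g t) = 1" for g :: "real \<Rightarrow> complex"
        using that(2) by (intro integrable_const_bound[where B = 1] measurable_compose[OF p_meas[OF 1] that(1)]) simp
      have "\<mu> = expectation (\<lambda>w. a (p 1 1 w)) + expectation (\<lambda>w. b (p 1 1 w))"
        unfolding mean[OF 1, symmetric] using int unit by (intro Bochner_Integration.integral_add) auto
      moreover have "expectation (\<lambda>w. a (p 1 1 w)) = (\<integral>t. f t *\<^sub>R a t \<partial>lborel)"
        by (rule expectation_density01[OF assms(3) dist[OF 1]]) measurable
      moreover have "cmod (expectation (\<lambda>w. b (p 1 1 w))) \<le> 1"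
        using integral_norm_bound[of "M 1" "\<lambda>w. b (p 1 1 w)"] prob_space by (simp add: unit)
      ultimately show ?thesis
        unfolding c_def by (metis add_left_mono norm_triangle_ineq order_trans)
    qed
    \<comment> \<open>The first entry encodes \<open>cmod \<mu> \<le> c + 1\<close>; the value
      \<open>3 / 4\<close> enforces \<open>1 / 2 \<le> r\<^sup>2\<close> while keeping
      \<open>r < 1\<close>.\<close>
    define r where "r = max ((c + 1) / 2) (3 / 4)"
    have r: "cmod \<mu> \<le> 2 * r" "3 / 4 \<le> r" "r < 1"
      using \<open>cmod \<mu> \<le> c + 1\<close> \<open>c < 1\<close> by (auto simp: r_def max_def field_simps)
    have r2: "1 / 2 \<le> r\<^sup>2" "r\<^sup>2 < 1"
      using power_mono[OF r(2), of 2] power_strict_mono[OF r(3), of 2] r(2)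
      by (simp_all add: power2_eq_square)
    \<comment> \<open>The initial volume contributes a common factor of modulus 1, which disappears
      in the modulus. The integrands agree only almost surely, where all proportions lie strictly
      between 0 and 1.\<close>
    have eq: "(\<integral>w. (cmod ((\<Sum>k\<in>I N. cis (2 * pi * of_int l * log 10 (X N k w))) / of_nat (card (I N))))\<^sup>2 \<partial>M N)
      = (\<integral>w. (cmod ((\<Sum>k\<in>I N. path_prod a b (\<lambda>i. p N i w) k) / 2 ^ n N))\<^sup>2 \<partial>M N)" for N
    proof (rule integral_cong_AE)
      have "(\<lambda>w. cis (2 * pi * of_int l * log 10 (X N k w))) \<in> borel_measurable (M N)" if "k \<in> I N" for k
        using measurable_compose[OF X_meas[OF that] a_meas] by (simp add: a_def)
      then have [measurable]: "(\<lambda>w. \<Sum>k\<in>I N. cis (2 * pi * of_int l * log 10 (X N k w))) \<in> borel_measurable (M N)"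
        by (rule borel_measurable_sum)
      show "(\<lambda>w. (cmod ((\<Sum>k\<in>I N. cis (2 * pi * of_int l * log 10 (X N k w))) / of_nat (card (I N))))\<^sup>2) \<in> borel_measurable (M N)"
        by measurable
      have "(\<lambda>w. path_prod a b (\<lambda>i. p N i w) k) \<in> borel_measurable (M N)" if "k \<in> I N" for k
        using that p_meas by (intro path_prod_measurable[where n = "2 ^ n N"]) (auto simp: I_def)
      then have [measurable]: "(\<lambda>w. \<Sum>k\<in>I N. path_prod a b (\<lambda>i. p N i w) k) \<in> borel_measurable (M N)"
        by (rule borel_measurable_sum)
      show "(\<lambda>w. (cmod ((\<Sum>k\<in>I N. path_prod a b (\<lambda>i. p N i w) k) / 2 ^ n N))\<^sup>2) \<in> borel_measurable (M N)"
        by measurable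
      show "AE w in M N. (cmod ((\<Sum>k\<in>I N. cis (2 * pi * of_int l * log 10 (X N k w))) / of_nat (card (I N))))\<^sup>2
        = (cmod ((\<Sum>k\<in>I N. path_prod a b (\<lambda>i. p N i w) k) / 2 ^ n N))\<^sup>2"
        using AE_p[of N]
      proof eventually_elim
        case (elim w)
        have "cis (2 * pi * of_int l * log 10 (X N k w))
            = cis (2 * pi * of_int l * log 10 V) * path_prod a b (\<lambda>i. p N i w) k" if "k \<in> I N" for k
        proof -
          have tw: "tree_weight (\<lambda>i. p N i w) k > 0"
            "cis (2 * pi * of_int l * log 10 (tree_weight (\<lambda>i. p N i w) k)) = path_prod a b (\<lambda>i. p N i w) k"
            using character_tree_weight[of "2 ^ n N" "\<lambda>i. p N i w" k "2 * pi * of_int l"] elim that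
            by (simp_all add: I_def a_def[abs_def] b_def[abs_def])
          have "log 10 (X N k w) = log 10 V + log 10 (tree_weight (\<lambda>i. p N i w) k)"
            using \<open>0 < V\<close> tw(1) by (simp add: X_def log_mult)
          then show ?thesis
            by (simp only: distrib_left cis_mult[symmetric] tw(2))
        qed
        then have "(\<Sum>k\<in>I N. cis (2 * pi * of_int l * log 10 (X N k w)))
            = cis (2 * pi * of_int l * log 10 V) * (\<Sum>k\<in>I N. path_prod a b (\<lambda>i. p N i w) k)"
          by (simp add: sum_distrib_left)
        then show ?case
          by (simp add: norm_divide norm_mult card_I norm_power)
      qed
    qed
    have le: "(\<integral>w. (cmod ((\<Sum>k\<in>I N. path_prod a b (\<lambda>i. p N i w) k) / 2 ^ n N))\<^sup>2 \<partial>M N)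
        \<le> (1 + 2 * real (n N)) * r\<^sup>2 ^ n N" for N
      unfolding I_def
      by (rule prob_space.path_average_second_moment[OF assms(7) indep a_meas b_meas unit mean r(1) r2(1)])
    have "(\<lambda>k. (1 + 2 * real k) * r\<^sup>2 ^ k) \<longlonglongrightarrow> 0"
    proof -
      have "(\<lambda>k. r\<^sup>2 ^ k + 2 * (real k * r\<^sup>2 ^ k)) \<longlonglongrightarrow> 0 + 2 * 0"
        using r2 by (intro tendsto_intros LIMSEQ_power_zero powser_times_n_limit_0) auto
      then show ?thesis by (simp add: algebra_simps)
    qed
    \<comment> \<open>From \<open>1 \<le> m\<close> one gets \<open>N \<le> n N\<close>, so the
      bound in the depth becomes a limit in the number of iterations.\<close>
    moreover have "filterlim n at_top sequentially"
      using \<open>1 \<le> m\<close> unfolding n_def by (intro filterlim_at_top_mono[OF filterlim_ident]) auto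
    ultimately have "(\<lambda>N. (1 + 2 * real (n N)) * r\<^sup>2 ^ n N) \<longlonglongrightarrow> 0"
      by (rule filterlim_compose)
    then show ?thesis
      unfolding eq by (rule Lim_null_comparison[rotated]) (simp add: le)
  qed
  have frac: "frac_pieces m (\<lambda>k. p N k w) B N s = (\<Sum>k\<in>I N. phi s (X N k w)) / of_nat (card (I N))" for N w
    unfolding frac_pieces_tree card_I assms(6) by (simp add: I_def X_def n_def)
  have lim: "(\<lambda>N. \<integral>w. \<bar>frac_pieces m (\<lambda>k. p N k w) B N s - log 10 s\<bar> \<partial>M N) \<longlonglongrightarrow> 0"
    unfolding frac using assms(10)
    by (intro weyl_significand assms(7) X_meas pos second) (auto simp: I_def)
  have meas: "(\<lambda>w. frac_pieces m (\<lambda>k. p N k w) B N s) \<in> borel_measurable (M N)" for N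
    unfolding frac using assms(10) X_meas
    by (intro borel_measurable_divide borel_measurable_sum borel_measurable_const measurable_compose[OF _ phi_measurable])
  show ?thesis
    using L1_limit_imp_mean_variance[OF assms(7) meas frac_pieces_bounds lim] by (rule conjI)
qed

end
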